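(* Let $d\in\mathbb N$ and $p\in[1,\infty)$. The $p$-Wasserstein topology on $\mathcal P_p(\mathbb R^d)$ is metrized by $$\mathcal V_p(\mathbb P,\mathbb Q):=\max\{V_p(\mathbb P,\mathbb Q),V_p(\mathbb Q,\mathbb P)\},$$ where $$V_p^p(\mathbb P,\mathbb Q):=\inf_{\pi\in\mathrm{Cpl}(\mathbb P,\mathbb Q)}\mathbb E_\pi\Big[\big\|\mathbb E_\pi[X-Y\mid X]\big\|^p\Big].$$
   Context: $\mathbb R^d$ carries the Euclidean norm $\|\cdot\|$. $\mathcal P_p(\mathbb R^d)$ is the set of Borel probability measures on $\mathbb R^d$ with finite $p$-th moment; the $p$-Wasserstein topology is induced by $\mathcal W_p^p(\mathbb P,\mathbb Q)=\inf_{\pi\in\mathrm{Cpl}(\mathbb P,\mathbb Q)}\mathbb E_\pi[\|X-Y\|^p]$. $\mathrm{Cpl}(\mathbb P,\mathbb Q)$ is the set of Borel probability measures on $\mathbb R^d\times\mathbb R^d$ with marginals $\mathbb P$ and $\mathbb Q$, and $X,Y$ denote the first and second coordinate projections on $\mathbb R^d\times\mathbb R^d$. $V_p$ is the nonnegative $p$-th root of $V_p^p$. *)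

theory Defs
  imports "HOL-Probability.Probability"
begin

definition finite_moment_measures :: "real \<Rightarrow> (real ^ 'n) measure set" where
  "finite_moment_measures p =
    {P. prob_space P \<and> sets P = sets borel \<and> integrable P (\<lambda>x. norm x powr p)}"

definition Cpl :: "(real ^ 'n) measure \<Rightarrow> (real ^ 'n) measure \<Rightarrow> ((real ^ 'n) \<times> (real ^ 'n)) measure set"
  where
  "Cpl P Q =
    {\<pi>. prob_space \<pi> \<and> sets \<pi> = sets borel \<and> distr \<pi> borel fst = P \<and> distr \<pi> borel snd = Q}"

text \<open>
  The costs are Lebesgue integrals in \<^typ>\<open>ennreal\<close>, so that a divergent integral counts as
  infinite. For measures with finite \<open>p\<close>-th moment and \<open>p \<ge> 1\<close> both infima below are
  finite, and \<^const>\<open>enn2real\<close> loses nothing.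
\<close>

definition wasserstein_dist :: "real \<Rightarrow> (real ^ 'n) measure \<Rightarrow> (real ^ 'n) measure \<Rightarrow> real" where
  "wasserstein_dist p P Q =
    enn2real (INF \<pi>\<in>Cpl P Q. \<integral>\<^sup>+z. ennreal (norm (fst z - snd z) powr p) \<partial>\<pi>) powr (1 / p)"

definition wasserstein_topology :: "real \<Rightarrow> (real ^ 'n) measure topology" where
  "wasserstein_topology p =
    Metric_space.mtopology (finite_moment_measures p) (wasserstein_dist p)"

text \<open>
  The library's conditional expectation is real-valued; a vector is conditioned componentwise.
\<close>

definition vec_cond_exp :: "'a measure \<Rightarrow> 'a measure \<Rightarrow> ('a \<Rightarrow> real ^ 'n) \<Rightarrow> 'a \<Rightarrow> real ^ 'n" where
  "vec_cond_exp M F f = (\<lambda>x. \<chi> i. real_cond_exp M F (\<lambda>y. f y $ i) x)"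

definition sigma_fst :: "((real ^ 'n) \<times> (real ^ 'n)) measure \<Rightarrow> ((real ^ 'n) \<times> (real ^ 'n)) measure" where
  "sigma_fst \<pi> = vimage_algebra (space \<pi>) fst borel"

lemma subalgebra_sigma_fst:
  fixes \<pi> :: "((real ^ 'n) \<times> (real ^ 'n)) measure"
  assumes "\<pi> \<in> Cpl P Q"
  shows "subalgebra \<pi> (sigma_fst \<pi>)"
proof -
  have sets: "sets \<pi> = sets borel"
    using assms by (simp add: Cpl_def)
  have "fst \<in> measurable \<pi> (borel :: (real ^ 'n) measure)"
    unfolding measurable_cong_sets[OF sets refl]
    by (intro borel_measurable_continuous_onI continuous_intros)
  then show ?thesis
    by (auto simp: subalgebra_def sigma_fst_def sets_vimage_algebra2 dest: measurable_sets)
qed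

definition V_pow :: "real \<Rightarrow> (real ^ 'n) measure \<Rightarrow> (real ^ 'n) measure \<Rightarrow> ennreal" where
  "V_pow p P Q =
    (INF \<pi>\<in>Cpl P Q.
      \<integral>\<^sup>+z. ennreal (norm (vec_cond_exp \<pi> (sigma_fst \<pi>) (\<lambda>w. fst w - snd w) z) powr p) \<partial>\<pi>)"

definition V :: "real \<Rightarrow> (real ^ 'n) measure \<Rightarrow> (real ^ 'n) measure \<Rightarrow> real" where
  "V p P Q = enn2real (V_pow p P Q) powr (1 / p)"

definition V_max :: "real \<Rightarrow> (real ^ 'n) measure \<Rightarrow> (real ^ 'n) measure \<Rightarrow> real" where
  "V_max p P Q = max (V p P Q) (V p Q P)"

end

theory Submission
  imports Defs
begin

text \<open>
  Conditional expectations contract \<open>L\<^sup>p\<close> norms, so \<open>V_max \<le> W\<^sub>p\<close>. The content of the theorem is that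
  \<open>V_max\<close> is a metric and that, near a fixed measure \<open>P\<close>, a small \<open>V_max\<close> forces a small \<open>W\<^sub>p\<close>.

  Couplings are handled through one notion. On a probability space with random vectors \<open>X\<close> and \<open>Y\<close>,
  call \<open>G\<close> a drift if \<open>X - Y\<close> and \<open>G\<close> have the same conditional expectation given \<open>X\<close>. By Jensen's
  inequality \<open>V p (law X) (law Y) \<le> \<parallel>G\<parallel>\<^sub>p\<close> for every drift (\<open>V_le_drift\<close>), while a nearly optimal
  coupling has a drift of nearly optimal norm, namely the conditional expectation itself
  (\<open>V_less_obtain\<close>). A drift may depend on everything, so drifts of different couplings can be added
  on a common probability space, and every upper bound for \<open>V\<close> comes from exhibiting one.

  Triangle inequality. Two couplings of \<open>P, Q\<close> and of \<open>Q, R\<close> are glued only approximately: the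
  space is cut into countably many cells of diameter at most \<open>\<delta>\<close>, and pairs \<open>(x, y)\<close> and \<open>(y', z)\<close>
  are drawn independently conditionally on \<open>y\<close> and \<open>y'\<close> lying in the same cell (\<open>gluing\<close>). This joint
  law has an explicit density with respect to the product of the two couplings. If \<open>F\<close> and \<open>G\<close> are drifts
  of the two couplings, then \<open>F(x, y) + (y - y') + G(y', z)\<close> is a drift from \<open>x\<close> to \<open>z\<close>, and
  Minkowski's inequality applies. The triangle inequality of \<open>W\<^sub>p\<close> follows from the same construction.

  From \<open>V_max\<close> to \<open>W\<^sub>p\<close>. If \<open>f\<close> is convex with subgradients bounded by \<open>L\<close>, then
  \<open>\<integral>f dP \<le> \<integral>f dQ + L * V p P Q\<close>. Hence \<open>V_max\<close> controls the integrals of differences of such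
  functions. They form a vector lattice that contains fine partitions of unity
  (\<open>partition_of_unity\<close>). Jensen's inequality for the convex function \<open>(\<parallel>x\<parallel> - R)\<^sub>+\<^sup>p\<close> shows that \<open>V\<close>
  also transports tail bounds from \<open>P\<close> to \<open>Q\<close> (\<open>tail_transfer\<close>). Given both, couple the parts of \<open>P\<close>
  and \<open>Q\<close> under each bump of the partition as far as their masses agree, and the remainders
  independently: matched mass moves little, and the remainder has a small \<open>p\<close>-th moment
  (\<open>W_pow_partition_le\<close>, \<open>residual_moment_le\<close>). This gives \<open>wasserstein_dist_le_of_V_max\<close>, and the
  definiteness of \<open>V_max\<close> is then inherited from that of \<open>W\<^sub>p\<close>.
\<close>

section \<open>Tangents of powers of the norm\<close>

lemma powr_above_tangent:
  fixes a b p :: real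
  assumes "0 \<le> a" "0 \<le> b" "1 \<le> p"
  shows "a powr p + p * a powr (p - 1) * (b - a) \<le> b powr p"
proof (cases "a = 0 \<or> b = 0")
  case True
  have "a powr (p - 1) * a = a powr p" if "0 < a"
    using that by (simp add: powr_mult_base mult.commute)
  moreover have "a powr p \<le> p * a powr p"
    using mult_right_mono[OF assms(3), of "a powr p"] by simp
  ultimately show ?thesis
    using True assms by (cases "a = 0") (auto simp: mult.assoc)
next
  case False
  then have pos: "0 < a" "0 < b" using assms by auto
  have "p * a powr (p - 1) * (b - a) \<le> b powr p - a powr p"
  proof (rule convex_on_imp_above_tangent[where A = "{0<..}"])
    show "convex_on {0<..} (\<lambda>x::real. x powr p)" using assms(3) by (rule powr_convex)
    show "((\<lambda>x. x powr p) has_real_derivative p * a powr (p - 1)) (at a within {0<..})"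
      using pos by (auto intro!: derivative_eq_intros)
  qed (use pos in \<open>auto simp: interior_open\<close>)
  then show ?thesis by simp
qed

definition excess :: "real \<Rightarrow> 'b::euclidean_space \<Rightarrow> real" where
  "excess R v = max 0 (norm v - R)"

text \<open>
  The value at \<open>v\<close> of a subgradient of \<open>(\<parallel>v\<parallel> - R)\<^sub>+\<^sup>p\<close>. Where the excess vanishes this is \<open>0\<close>, also
  for \<open>p = 1\<close>, because \<open>0 powr 0 = 0\<close>.
\<close>

definition excess_grad :: "real \<Rightarrow> real \<Rightarrow> 'b::euclidean_space \<Rightarrow> 'b" where
  "excess_grad p R v = (p * excess R v powr (p - 1)) *\<^sub>R sgn v"

lemma excess_nonneg [simp]: "0 \<le> excess R v"
  by (simp add: excess_def)

lemma excess_0 [simp]: "excess 0 v = norm v"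
  by (simp add: excess_def)

lemma borel_measurable_excess [measurable]: "excess R \<in> borel_measurable borel"
  unfolding excess_def by measurable

lemma borel_measurable_excess_grad [measurable]:
  "excess_grad p R \<in> borel_measurable (borel :: 'b::euclidean_space measure)"
  unfolding excess_grad_def sgn_div_norm by measurable

lemma excess_powr_above_tangent:
  fixes g h :: "'b::euclidean_space"
  assumes "0 \<le> R" "1 \<le> p"
  shows "excess R h powr p + excess_grad p R h \<bullet> (g - h) \<le> excess R g powr p"
proof (cases "norm h \<le> R")
  case True
  then show ?thesis by (simp add: excess_def excess_grad_def)
next
  case False
  then have h: "0 < norm h" "excess R h = norm h - R" using assms(1) by (auto simp: excess_def)
  have "sgn h \<bullet> (g - h) = sgn h \<bullet> g - norm h"
    using h by (simp add: sgn_div_norm inner_diff_right divide_simps power2_norm_eq_inner[symmetric] power2_eq_square)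
  also have "\<dots> \<le> norm g - norm h"
    using Cauchy_Schwarz_ineq2[of "sgn h" g] h by (auto simp: norm_sgn)
  also have "\<dots> \<le> excess R g - excess R h" using h by (simp add: excess_def)
  finally have "(p * excess R h powr (p - 1)) * (sgn h \<bullet> (g - h))
      \<le> (p * excess R h powr (p - 1)) * (excess R g - excess R h)"
    using assms(2) by (intro mult_left_mono) auto
  then show ?thesis
    using powr_above_tangent[of "excess R h" "excess R g" p] assms(2)
    unfolding excess_grad_def inner_scaleR_left by (meson add_left_mono dual_order.trans excess_nonneg)
qed

section \<open>Conditional Jensen inequality\<close>

text \<open>
  If \<open>D\<close> has conditional expectation \<open>0\<close> given \<open>F\<close>, then it is orthogonal to every bounded
  \<open>F\<close>-measurable vector field. The real-valued conditional expectation is applied to each coordinate.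
\<close>

lemma subalgebra_orthogonal_bounded:
  fixes D w :: "'a \<Rightarrow> 'b::euclidean_space"
  assumes "prob_space M" and F: "subalgebra M F" and D: "integrable M D"
    and zero: "\<And>A. A \<in> sets F \<Longrightarrow> (\<integral>x. indicator A x *\<^sub>R D x \<partial>M) = 0"
    and w[measurable]: "w \<in> borel_measurable F" and bound: "\<And>x. norm (w x) \<le> L"
  shows "integrable M (\<lambda>x. w x \<bullet> D x)" "(\<integral>x. w x \<bullet> D x \<partial>M) = 0"
proof -
  interpret prob_space M by fact
  interpret finite_measure_subalgebra M F by standard fact
  have wM[measurable]: "w \<in> borel_measurable M" by (rule measurable_from_subalg[OF F w])
  have Dm[measurable]: "D \<in> borel_measurable M" using D by auto
  have comp: "integrable M (\<lambda>x. (w x \<bullet> b) * (D x \<bullet> b)) \<and> (\<integral>x. (w x \<bullet> b) * (D x \<bullet> b) \<partial>M) = 0"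
    if b: "b \<in> Basis" for b
  proof
    have Db: "integrable M (\<lambda>x. D x \<bullet> b)" using D by simp
    show int: "integrable M (\<lambda>x. (w x \<bullet> b) * (D x \<bullet> b))"
    proof (rule Bochner_Integration.integrable_bound[where f = "\<lambda>x. L * norm (D x \<bullet> b)"])
      show "AE x in M. norm ((w x \<bullet> b) * (D x \<bullet> b)) \<le> norm (L * norm (D x \<bullet> b))"
      proof (rule AE_I2)
        fix x
        have "\<bar>w x \<bullet> b\<bar> \<le> L" using Basis_le_norm[OF b, of "w x"] bound[of x] by linarith
        then show "norm ((w x \<bullet> b) * (D x \<bullet> b)) \<le> norm (L * norm (D x \<bullet> b))"
          by (auto simp: abs_mult intro!: mult_right_mono)
      qed
    qed (use Db in auto)
    have "AE x in M. real_cond_exp M F (\<lambda>x. D x \<bullet> b) x = 0"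
    proof (rule real_cond_exp_charact)
      fix A assume A: "A \<in> sets F"
      then have "A \<in> sets M" using F by (auto simp: subalgebra_def)
      then have iA: "integrable M (\<lambda>x. indicator A x *\<^sub>R D x)"
        by (intro integrable_mult_indicator D)
      have "(\<integral>x\<in>A. D x \<bullet> b \<partial>M) = (\<integral>x. (indicator A x *\<^sub>R D x) \<bullet> b \<partial>M)"
        by (simp add: set_lebesgue_integral_def)
      also have "\<dots> = (\<integral>x. indicator A x *\<^sub>R D x \<partial>M) \<bullet> b"
        using iA by (rule integral_inner_left)
      finally show "(\<integral>x\<in>A. D x \<bullet> b \<partial>M) = (\<integral>x\<in>A. 0 \<partial>M)" using zero[OF A] by simp
    qed (use Db in auto)
    then have "(\<integral>x. (w x \<bullet> b) * real_cond_exp M F (\<lambda>x. D x \<bullet> b) x \<partial>M) = 0"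
      by (subst integral_cong_AE[where g = "\<lambda>_. 0"]) auto
    then show "(\<integral>x. (w x \<bullet> b) * (D x \<bullet> b) \<partial>M) = 0"
      using real_cond_exp_intg(2)[of "\<lambda>x. w x \<bullet> b" "\<lambda>x. D x \<bullet> b"] int by simp
  qed
  have eq: "w x \<bullet> D x = (\<Sum>b\<in>Basis. (w x \<bullet> b) * (D x \<bullet> b))" for x
    by (rule euclidean_inner)
  show "integrable M (\<lambda>x. w x \<bullet> D x)" unfolding eq using comp by auto
  show "(\<integral>x. w x \<bullet> D x \<partial>M) = 0" unfolding eq using comp by simp
qed

text \<open>
  The hypotheses say that \<open>H\<close> is the conditional expectation of \<open>G\<close> given \<open>F\<close>. Integrating the tangent
  inequality for \<open>(\<parallel>v\<parallel> - R)\<^sub>+\<^sup>p\<close> at \<open>H\<close> gives the claim, since the subgradient is orthogonal to \<open>G - H\<close>.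
  The subgradient need not be bounded, so this is done on \<open>{\<parallel>H\<parallel> \<le> n}\<close> first; Fatou's lemma
  removes the truncation.
\<close>

lemma conditional_jensen_excess:
  fixes H G :: "'a \<Rightarrow> 'b::euclidean_space"
  assumes M: "prob_space M" and F: "subalgebra M F"
    and H: "H \<in> borel_measurable F" "integrable M H" and G: "integrable M G"
    and eq: "\<And>A. A \<in> sets F \<Longrightarrow> (\<integral>x. indicator A x *\<^sub>R (G x - H x) \<partial>M) = 0"
    and R: "0 \<le> R" and p: "1 \<le> p"
  shows "(\<integral>\<^sup>+x. ennreal (excess R (H x) powr p) \<partial>M) \<le> (\<integral>\<^sup>+x. ennreal (excess R (G x) powr p) \<partial>M)"
proof (cases "(\<integral>\<^sup>+x. ennreal (excess R (G x) powr p) \<partial>M) < \<infinity>")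
  case False
  then show ?thesis by (metis infinity_ennreal_def less_top top_greatest)
next
  case True
  interpret prob_space M by fact
  have HF[measurable]: "H \<in> borel_measurable F" by fact
  have [measurable]: "H \<in> borel_measurable M" "G \<in> borel_measurable M" using H G by auto
  have intG: "integrable M (\<lambda>x. excess R (G x) powr p)"
    by (rule integrableI_bounded) (use True in auto)
  define B where "B n = {v::'b. norm v \<le> real n}" for n
  have [measurable]: "B n \<in> sets borel" for n unfolding B_def by measurable
  define w where "w n x = indicator (B n) (H x) *\<^sub>R excess_grad p R (H x)" for n x
  have wF[measurable]: "w n \<in> borel_measurable F" for n unfolding w_def by measurable
  have bound: "norm (w n x) \<le> p * real n powr (p - 1)" for n x
  proof (cases "H x \<in> B n")
    case True
    then have "excess R (H x) \<le> real n" using R by (auto simp: B_def excess_def)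
    then have "excess R (H x) powr (p - 1) \<le> real n powr (p - 1)"
      using p by (intro powr_mono2) auto
    then have "p * excess R (H x) powr (p - 1) * norm (sgn (H x)) \<le> p * real n powr (p - 1) * 1"
      using p by (intro mult_mono) (auto simp: norm_sgn)
    then show ?thesis using True p by (simp add: w_def excess_grad_def)
  next
    case False
    then show ?thesis using p by (simp add: w_def)
  qed
  have trunc: "(\<integral>\<^sup>+x. ennreal (indicator (B n) (H x) * excess R (H x) powr p) \<partial>M)
     \<le> (\<integral>\<^sup>+x. ennreal (excess R (G x) powr p) \<partial>M)" for n
  proof -
    have D: "integrable M (\<lambda>x. G x - H x)" using H G by auto
    note orth = subalgebra_orthogonal_bounded[OF M F D eq wF bound, of n]
    have ptw: "indicator (B n) (H x) * excess R (H x) powr p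
        \<le> excess R (G x) powr p - w n x \<bullet> (G x - H x)" for x
      using excess_powr_above_tangent[OF R p, of "H x" "G x"]
      by (auto simp: w_def indicator_def)
    have nonneg: "0 \<le> excess R (G x) powr p - w n x \<bullet> (G x - H x)" for x
      by (rule order_trans[OF _ ptw]) (simp add: indicator_def)
    have int: "integrable M (\<lambda>x. excess R (G x) powr p - w n x \<bullet> (G x - H x))"
      using intG orth(1) by auto
    have "(\<integral>\<^sup>+x. ennreal (indicator (B n) (H x) * excess R (H x) powr p) \<partial>M)
      \<le> (\<integral>\<^sup>+x. ennreal (excess R (G x) powr p - w n x \<bullet> (G x - H x)) \<partial>M)"
      by (intro nn_integral_mono ennreal_leI ptw)
    also have "\<dots> = ennreal (\<integral>x. excess R (G x) powr p - w n x \<bullet> (G x - H x) \<partial>M)"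
      using int by (rule nn_integral_eq_integral)(intro AE_I2 nonneg)
    also have "\<dots> = ennreal (\<integral>x. excess R (G x) powr p \<partial>M)"
      using intG orth by simp
    also have "\<dots> = (\<integral>\<^sup>+x. ennreal (excess R (G x) powr p) \<partial>M)"
      using intG by (rule nn_integral_eq_integral[symmetric]) auto
    finally show ?thesis .
  qed
  have "(\<integral>\<^sup>+x. ennreal (excess R (H x) powr p) \<partial>M)
    = (\<integral>\<^sup>+x. liminf (\<lambda>n. ennreal (indicator (B n) (H x) * excess R (H x) powr p)) \<partial>M)"
  proof (rule nn_integral_cong)
    fix x
    obtain N where N: "norm (H x) \<le> real N" using real_arch_simple by blast
    have "eventually (\<lambda>n. ennreal (indicator (B n) (H x) * excess R (H x) powr p) = ennreal (excess R (H x) powr p)) sequentially"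
      using eventually_ge_at_top[of N] by eventually_elim (use N in \<open>auto simp: B_def indicator_def\<close>)
    then have "(\<lambda>n. ennreal (indicator (B n) (H x) * excess R (H x) powr p)) \<longlonglongrightarrow> ennreal (excess R (H x) powr p)"
      by (rule tendsto_eventually)
    then show "ennreal (excess R (H x) powr p) = liminf (\<lambda>n. ennreal (indicator (B n) (H x) * excess R (H x) powr p))"
      by (intro lim_imp_Liminf[symmetric]) auto
  qed
  also have "\<dots> \<le> liminf (\<lambda>n. \<integral>\<^sup>+x. ennreal (indicator (B n) (H x) * excess R (H x) powr p) \<partial>M)"
    by (intro nn_integral_liminf) measurable
  also have "\<dots> \<le> liminf (\<lambda>n::nat. \<integral>\<^sup>+x. ennreal (excess R (G x) powr p) \<partial>M)"
    by (intro Liminf_mono always_eventually allI trunc)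
  also have "\<dots> = (\<integral>\<^sup>+x. ennreal (excess R (G x) powr p) \<partial>M)"
    by (simp add: Liminf_const)
  finally show ?thesis .
qed

section \<open>Inequalities for p-th powers\<close>

lemma powr_le_one_plus:
  fixes t :: real assumes "0 \<le> t" "1 \<le> p" shows "t \<le> 1 + t powr p"
proof (cases "t \<le> 1")
  case True then show ?thesis by (simp add: add_increasing2)
next
  case False
  then have "t powr 1 \<le> t powr p" using assms by (intro powr_mono) auto
  then show ?thesis using False by simp
qed

lemma add_powr_le:
  fixes s t :: real assumes "0 \<le> s" "0 \<le> t" "1 \<le> p"
  shows "(s + t) powr p \<le> 2 powr p * (s powr p + t powr p)"
proof -
  have "(s + t) powr p \<le> (2 * max s t) powr p" using assms by (intro powr_mono2) auto
  also have "\<dots> = 2 powr p * max s t powr p" using assms by (simp add: powr_mult)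
  also have "\<dots> \<le> 2 powr p * (s powr p + t powr p)"
    by (intro mult_left_mono) (auto simp: max_def)
  finally show ?thesis .
qed

lemma norm_diff_powr_le:
  fixes x y :: "'b::real_normed_vector" assumes "1 \<le> p"
  shows "norm (x - y) powr p \<le> 2 powr p * (norm x powr p + norm y powr p)"
  using add_powr_le[of "norm x" "norm y" p] assms
    powr_mono2[of p "norm (x - y)" "norm x + norm y"] norm_triangle_ineq4[of x y] by auto

text \<open>
  The form of Minkowski's inequality in which bounds on the norms are given. It is the convexity of
  \<open>t powr p\<close>, applied to \<open>(f + g) / (a + b)\<close> as the convex combination of \<open>f / a\<close> and \<open>g / b\<close> with
  weights \<open>a / (a + b)\<close> and \<open>b / (a + b)\<close>.
\<close>

lemma minkowski_le:
  fixes f g :: "'a \<Rightarrow> real"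
  assumes [measurable]: "f \<in> borel_measurable M" "g \<in> borel_measurable M"
    and nn: "\<And>x. 0 \<le> f x" "\<And>x. 0 \<le> g x"
    and pos: "0 < a" "0 < b" and p: "1 \<le> p"
    and f: "(\<integral>\<^sup>+x. ennreal (f x powr p) \<partial>M) \<le> ennreal (a powr p)"
    and g: "(\<integral>\<^sup>+x. ennreal (g x powr p) \<partial>M) \<le> ennreal (b powr p)"
  shows "(\<integral>\<^sup>+x. ennreal ((f x + g x) powr p) \<partial>M) \<le> ennreal ((a + b) powr p)"
proof -
  define A B where "A = (a + b) powr (p - 1) * a powr (1 - p)"
    and "B = (a + b) powr (p - 1) * b powr (1 - p)"
  have AB: "0 \<le> A" "0 \<le> B" by (auto simp: A_def B_def)
  have ptw: "(f x + g x) powr p \<le> A * f x powr p + B * g x powr p" for x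
  proof -
    define s where "s = (f x + g x) / (a + b)"
    have s: "0 \<le> s" using nn pos by (simp add: s_def)
    \<comment> \<open>The point s is the weighted mean of f x / a and g x / b, so the linear terms cancel.\<close>
    have 1: "s powr p + p * s powr (p - 1) * (f x / a - s) \<le> (f x / a) powr p"
      using nn pos s p by (intro powr_above_tangent) auto
    have 2: "s powr p + p * s powr (p - 1) * (g x / b - s) \<le> (g x / b) powr p"
      using nn pos s p by (intro powr_above_tangent) auto
    define c where "c = p * s powr (p - 1)"
    have "a * (s powr p + c * (f x / a - s)) + b * (s powr p + c * (g x / b - s))
      \<le> a * (f x / a) powr p + b * (g x / b) powr p"
      using 1 2 pos unfolding c_def by (intro add_mono mult_left_mono) auto
    moreover have "a * (s powr p + c * (f x / a - s)) + b * (s powr p + c * (g x / b - s))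
      = (a + b) * s powr p + c * (f x + g x - (a + b) * s)"
      using pos by (simp add: field_simps)
    moreover have "(a + b) * s = f x + g x" using pos by (simp add: s_def)
    ultimately have 3: "(a + b) * s powr p \<le> a * (f x / a) powr p + b * (g x / b) powr p"
      by simp
    have "(f x + g x) powr p = (a + b) powr p * s powr p"
      using pos nn by (simp add: s_def powr_divide)
    also have "\<dots> = (a + b) powr (p - 1) * ((a + b) * s powr p)"
      using pos by (simp add: powr_diff)
    also have "\<dots> \<le> (a + b) powr (p - 1) * (a * (f x / a) powr p + b * (g x / b) powr p)"
      using 3 by (intro mult_left_mono) auto
    also have "\<dots> = A * f x powr p + B * g x powr p"
    proof -
      have "a * (f x / a) powr p = a powr (1 - p) * f x powr p"
        "b * (g x / b) powr p = b powr (1 - p) * g x powr p"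
        using pos nn by (simp_all add: powr_diff powr_divide)
      then show ?thesis by (simp add: A_def B_def distrib_left mult.assoc)
    qed
    finally show ?thesis .
  qed
  have "(\<integral>\<^sup>+x. ennreal ((f x + g x) powr p) \<partial>M)
     \<le> (\<integral>\<^sup>+x. ennreal A * ennreal (f x powr p) + ennreal B * ennreal (g x powr p) \<partial>M)"
    using ptw AB by (intro nn_integral_mono) (auto simp: ennreal_mult[symmetric] simp flip: ennreal_plus)
  also have "\<dots> = ennreal A * (\<integral>\<^sup>+x. ennreal (f x powr p) \<partial>M) + ennreal B * (\<integral>\<^sup>+x. ennreal (g x powr p) \<partial>M)"
    by (simp add: nn_integral_add nn_integral_cmult)
  also have "\<dots> \<le> ennreal A * ennreal (a powr p) + ennreal B * ennreal (b powr p)"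
    by (intro add_mono mult_left_mono f g) auto
  also have "\<dots> = ennreal (A * a powr p + B * b powr p)"
    using AB by (simp add: ennreal_mult[symmetric] flip: ennreal_plus)
  also have "A * a powr p + B * b powr p = (a + b) powr p"
  proof -
    have "a powr (1 - p) * a powr p = a" "b powr (1 - p) * b powr p = b"
      using pos by (simp_all flip: powr_add)
    then have "A * a powr p + B * b powr p = (a + b) powr (p - 1) * (a + b)"
      by (simp add: A_def B_def distrib_left mult.assoc)
    then show ?thesis using pos by (simp add: powr_diff)
  qed
  finally show ?thesis .
qed

text \<open>
  The \<open>L\<^sup>1\<close> norm is at most the \<open>L\<^sup>p\<close> norm: integrate the tangent inequality of \<open>t powr p\<close> at \<open>a\<close>.
\<close>

lemma (in prob_space) mean_norm_le:
  fixes G :: "'a \<Rightarrow> 'b::euclidean_space"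
  assumes [measurable]: "G \<in> borel_measurable M" and p: "1 \<le> p" and a: "0 < a"
    and le: "(\<integral>\<^sup>+x. ennreal (norm (G x) powr p) \<partial>M) \<le> ennreal (a powr p)"
  shows "integrable M G" "(\<integral>x. norm (G x) \<partial>M) \<le> a"
proof -
  have intp: "integrable M (\<lambda>x. norm (G x) powr p)"
    by (rule integrableI_bounded) (use le in \<open>auto simp: le_less_trans\<close>)
  show int: "integrable M G"
    by (rule Bochner_Integration.integrable_bound[where f = "\<lambda>x. 1 + norm (G x) powr p"])
      (use intp powr_le_one_plus[OF _ p] in \<open>auto simp: abs_of_nonneg\<close>)
  have "(\<integral>x. norm (G x) powr p \<partial>M) \<le> a powr p"
    using le nn_integral_eq_integral[OF intp] by (simp add: ennreal_le_iff)
  moreover have "(\<integral>x. a powr p + p * a powr (p - 1) * (norm (G x) - a) \<partial>M) \<le> (\<integral>x. norm (G x) powr p \<partial>M)"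
    using int intp a p powr_above_tangent[of a _ p] by (intro integral_mono) auto
  moreover have "(\<integral>x. a powr p + p * a powr (p - 1) * (norm (G x) - a) \<partial>M)
      = a powr p + p * a powr (p - 1) * ((\<integral>x. norm (G x) \<partial>M) - a)"
    using int by (simp add: prob_space)
  ultimately have "p * a powr (p - 1) * ((\<integral>x. norm (G x) \<partial>M) - a) \<le> 0" by linarith
  then show "(\<integral>x. norm (G x) \<partial>M) \<le> a"
    using a p by (auto simp: mult_le_0_iff)
qed

section \<open>Drifts of couplings\<close>

text \<open>
  The vector \<open>G\<close> has the same conditional expectation given \<open>X\<close> as \<open>X - Y\<close>. It need not be a function of
  \<open>X\<close>: in this way drifts on a large probability space can be added without conditioning first.
\<close>

definition drift :: "'a measure \<Rightarrow> ('a \<Rightarrow> 'b::euclidean_space) \<Rightarrow> ('a \<Rightarrow> 'b) \<Rightarrow> ('a \<Rightarrow> 'b) \<Rightarrow> bool" where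
  "drift M X Y G \<longleftrightarrow> integrable M X \<and> integrable M Y \<and> integrable M G \<and>
     (\<forall>A\<in>sets borel. (\<integral>\<omega>. indicator A (X \<omega>) *\<^sub>R (X \<omega> - Y \<omega> - G \<omega>) \<partial>M) = 0)"

lemma drift_self:
  assumes "integrable M X" "integrable M Y" shows "drift M X Y (\<lambda>\<omega>. X \<omega> - Y \<omega>)"
  using assms by (simp add: drift_def)

lemma vec_as_sum: "(x :: real^'n) = (\<Sum>i\<in>UNIV. (x $ i) *\<^sub>R axis i 1)"
  by (simp add: vec_eq_iff axis_def if_distrib cong: if_cong)

lemma Cpl_prob: "\<pi> \<in> Cpl P Q \<Longrightarrow> prob_space \<pi>"
  and Cpl_sets: "\<pi> \<in> Cpl P Q \<Longrightarrow> sets \<pi> = sets borel"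
  by (auto simp: Cpl_def)

lemma Cpl_space: "\<pi> \<in> Cpl P Q \<Longrightarrow> space \<pi> = UNIV"
  using sets_eq_imp_space_eq[of \<pi> borel] by (auto simp: Cpl_def)

lemma drift_vec_cond_exp:
  fixes P Q :: "(real^'n) measure"
  assumes \<pi>: "\<pi> \<in> Cpl P Q" and int: "integrable \<pi> fst" "integrable \<pi> snd"
  defines "H \<equiv> vec_cond_exp \<pi> (sigma_fst \<pi>) (\<lambda>w. fst w - snd w)"
  shows "H \<in> borel_measurable (sigma_fst \<pi>)" "drift \<pi> fst snd H"
proof -
  interpret prob_space \<pi> using \<pi> by (rule Cpl_prob)
  let ?F = "sigma_fst \<pi>"
  have sub: "subalgebra \<pi> ?F" using \<pi> by (rule subalgebra_sigma_fst)
  interpret finite_measure_subalgebra \<pi> ?F by standard fact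
  define c where "c i = real_cond_exp \<pi> ?F (\<lambda>w. (fst w - snd w) $ i)" for i
  have H: "H = (\<lambda>x. \<Sum>i\<in>UNIV. c i x *\<^sub>R axis i 1)"
    unfolding H_def c_def vec_cond_exp_def by (subst vec_as_sum) simp
  have comp: "integrable \<pi> (\<lambda>w. (fst w - snd w) $ i)" for i
  proof -
    have "integrable \<pi> (\<lambda>w. (fst w - snd w) \<bullet> axis i 1)" using int by auto
    then show ?thesis by (simp add: inner_axis)
  qed
  show HF: "H \<in> borel_measurable ?F" unfolding H c_def by measurable
  have cint: "integrable \<pi> (c i)" for i unfolding c_def using comp by (rule real_cond_exp_int(1))
  have Hint: "integrable \<pi> H" unfolding H using cint by auto
  have "(\<integral>\<omega>. indicator A (fst \<omega>) *\<^sub>R (fst \<omega> - snd \<omega> - H \<omega>) \<partial>\<pi>) = 0" if A: "A \<in> sets borel" for A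
  proof -
    define A' where "A' = fst -` A \<inter> space \<pi>"
    have A'F: "A' \<in> sets ?F" using A by (auto simp: A'_def sigma_fst_def sets_vimage_algebra2)
    then have A'M: "A' \<in> sets \<pi>" using sub by (auto simp: subalgebra_def)
    have ind: "indicator A (fst \<omega>) = (indicator A' \<omega> :: real)" for \<omega>
      using Cpl_space[OF \<pi>] by (auto simp: A'_def indicator_def)
    have D: "integrable \<pi> (\<lambda>\<omega>. indicator A' \<omega> *\<^sub>R (fst \<omega> - snd \<omega> - H \<omega>))"
      using int Hint by (intro integrable_mult_indicator A'M) auto
    have "(\<integral>\<omega>. indicator A' \<omega> *\<^sub>R (fst \<omega> - snd \<omega> - H \<omega>) \<partial>\<pi>) $ i = 0" for i
    proof -
      have "(\<integral>\<omega>. indicator A' \<omega> *\<^sub>R (fst \<omega> - snd \<omega> - H \<omega>) \<partial>\<pi>) \<bullet> axis i 1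
         = (\<integral>\<omega>. (indicator A' \<omega> *\<^sub>R (fst \<omega> - snd \<omega> - H \<omega>)) \<bullet> axis i 1 \<partial>\<pi>)"
        using D by (rule integral_inner_left[symmetric])
      also have "\<dots> = (\<integral>\<omega>. indicator A' \<omega> *\<^sub>R (fst \<omega> - snd \<omega>) $ i - indicator A' \<omega> *\<^sub>R c i \<omega> \<partial>\<pi>)"
        by (intro Bochner_Integration.integral_cong)
          (auto simp: inner_axis H_def vec_cond_exp_def c_def algebra_simps)
      also have "\<dots> = (\<integral>\<omega>\<in>A'. (fst \<omega> - snd \<omega>) $ i \<partial>\<pi>) - (\<integral>\<omega>\<in>A'. c i \<omega> \<partial>\<pi>)"
        unfolding set_lebesgue_integral_def
        by (intro Bochner_Integration.integral_diff integrable_mult_indicator A'M comp cint)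
      also have "\<dots> = 0" unfolding c_def using real_cond_exp_intA[OF comp A'F, of i] by simp
      finally show ?thesis by (simp add: inner_axis)
    qed
    then show ?thesis by (simp add: ind vec_eq_iff)
  qed
  then show "drift \<pi> fst snd H" using int Hint by (simp add: drift_def)
qed

lemma borel_measurable_fst_snd [measurable]:
  "fst \<in> borel_measurable (borel :: ((real^'n) \<times> (real^'n)) measure)"
  "snd \<in> borel_measurable (borel :: ((real^'n) \<times> (real^'n)) measure)"
  by (auto intro!: borel_measurable_continuous_onI continuous_intros)

lemma coupling_of_pair:
  fixes X Y :: "'a \<Rightarrow> real^'n"
  assumes "prob_space M" and [measurable]: "X \<in> borel_measurable M" "Y \<in> borel_measurable M"
  shows "distr M borel (\<lambda>\<omega>. (X \<omega>, Y \<omega>)) \<in> Cpl (distr M borel X) (distr M borel Y)"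
proof -
  interpret prob_space M by fact
  have [measurable]: "(\<lambda>\<omega>. (X \<omega>, Y \<omega>)) \<in> borel_measurable M" by (intro borel_measurable_Pair) auto
  show ?thesis
    by (auto simp: Cpl_def distr_distr comp_def intro!: prob_space_distr)
qed

text \<open>
  Let \<open>H\<close> be the conditional expectation that defines the cost of the joint law of \<open>X\<close> and \<open>Y\<close>. Pulled back
  along \<open>(X, Y)\<close>, it is the conditional expectation of \<open>G\<close> given \<open>X\<close>, so Jensen's inequality with \<open>R = 0\<close>
  bounds its norm.
\<close>

lemma V_pow_le_drift:
  fixes X Y G :: "'a \<Rightarrow> real^'n"
  assumes M: "prob_space M" and dr: "drift M X Y G" and p: "1 \<le> p"
  shows "V_pow p (distr M borel X) (distr M borel Y) \<le> (\<integral>\<^sup>+\<omega>. ennreal (norm (G \<omega>) powr p) \<partial>M)"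
proof -
  interpret prob_space M by fact
  have int: "integrable M X" "integrable M Y" "integrable M G"
    and eq: "\<And>A. A \<in> sets borel \<Longrightarrow> (\<integral>\<omega>. indicator A (X \<omega>) *\<^sub>R (X \<omega> - Y \<omega> - G \<omega>) \<partial>M) = 0"
    using dr by (auto simp: drift_def)
  have [measurable]: "X \<in> borel_measurable M" "Y \<in> borel_measurable M" "G \<in> borel_measurable M"
    using int by auto
  define Z where "Z \<omega> = (X \<omega>, Y \<omega>)" for \<omega>
  have Z[measurable]: "Z \<in> borel_measurable M" unfolding Z_def by (intro borel_measurable_Pair) auto
  define \<pi> where "\<pi> = distr M borel Z"
  have \<pi>: "\<pi> \<in> Cpl (distr M borel X) (distr M borel Y)"
    unfolding \<pi>_def Z_def by (rule coupling_of_pair[OF M]) auto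
  have "integrable \<pi> fst" "integrable \<pi> snd"
    unfolding \<pi>_def by (auto simp: integrable_distr_eq Z_def int)
  note cond = drift_vec_cond_exp[OF \<pi> this]
  define H where "H = vec_cond_exp \<pi> (sigma_fst \<pi>) (\<lambda>w. fst w - snd w)"
  have Hm: "H \<in> borel_measurable (sigma_fst \<pi>)" and Hd: "drift \<pi> fst snd H"
    using cond by (auto simp: H_def)
  have Hi: "integrable \<pi> H" using Hd by (simp add: drift_def)
  then have Hb[measurable]: "H \<in> borel_measurable borel" by (auto simp: \<pi>_def)
  have HZi: "integrable M (\<lambda>\<omega>. H (Z \<omega>))"
    using Hi unfolding \<pi>_def by (simp add: integrable_distr_eq)
  define F where "F = vimage_algebra (space M) X borel"
  have sub: "subalgebra M F"
    by (auto simp: subalgebra_def F_def sets_vimage_algebra2)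
  have ZF: "Z \<in> measurable F (sigma_fst \<pi>)"
    unfolding sigma_fst_def
    by (rule measurable_vimage_algebra2)
      (auto simp: F_def Z_def \<pi>_def intro!: measurable_vimage_algebra1)
  have HZF: "(\<lambda>\<omega>. H (Z \<omega>)) \<in> borel_measurable F"
    using measurable_compose[OF ZF Hm] .
  have le: "(\<integral>\<^sup>+\<omega>. ennreal (excess 0 (H (Z \<omega>)) powr p) \<partial>M) \<le> (\<integral>\<^sup>+\<omega>. ennreal (excess 0 (G \<omega>) powr p) \<partial>M)"
  proof (rule conditional_jensen_excess[OF M sub HZF HZi int(3)])
    fix A' assume "A' \<in> sets F"
    then obtain A where A[measurable]: "A \<in> sets borel" and A': "A' = X -` A \<inter> space M"
      by (auto simp: F_def sets_vimage_algebra2)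
    have iA: "integrable M (\<lambda>\<omega>. indicator A (X \<omega>) *\<^sub>R f \<omega>)" if "integrable M f" for f :: "'a \<Rightarrow> real^'n"
    proof -
      have "integrable M (\<lambda>\<omega>. indicator (X -` A \<inter> space M) \<omega> *\<^sub>R f \<omega>)"
        using that by (intro integrable_mult_indicator) auto
      then show ?thesis
        by (rule Bochner_Integration.integrable_cong[THEN iffD1, rotated 2]) (auto simp: indicator_def)
    qed
    have "(\<integral>w. indicator A (fst w) *\<^sub>R (fst w - snd w - H w) \<partial>\<pi>) = 0"
      using Hd A by (simp add: drift_def)
    then have H0: "(\<integral>\<omega>. indicator A (X \<omega>) *\<^sub>R (X \<omega> - Y \<omega> - H (Z \<omega>)) \<partial>M) = 0"
      unfolding \<pi>_def by (subst (asm) integral_distr) (auto simp: Z_def)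
    have "(\<integral>\<omega>. indicator A' \<omega> *\<^sub>R (G \<omega> - H (Z \<omega>)) \<partial>M)
      = (\<integral>\<omega>. indicator A (X \<omega>) *\<^sub>R (X \<omega> - Y \<omega> - H (Z \<omega>)) - indicator A (X \<omega>) *\<^sub>R (X \<omega> - Y \<omega> - G \<omega>) \<partial>M)"
      by (intro Bochner_Integration.integral_cong) (auto simp: A' indicator_def)
    also have "\<dots> = 0"
      using H0 eq[OF A] iA int HZi by (subst Bochner_Integration.integral_diff) auto
    finally show "(\<integral>\<omega>. indicator A' \<omega> *\<^sub>R (G \<omega> - H (Z \<omega>)) \<partial>M) = 0" .
  qed (use p in auto)
  have "V_pow p (distr M borel X) (distr M borel Y) \<le> (\<integral>\<^sup>+z. ennreal (norm (H z) powr p) \<partial>\<pi>)"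
    unfolding V_pow_def H_def by (rule INF_lower[OF \<pi>])
  also have "\<dots> = (\<integral>\<^sup>+\<omega>. ennreal (norm (H (Z \<omega>)) powr p) \<partial>M)"
    unfolding \<pi>_def by (rule nn_integral_distr) auto
  also have "\<dots> \<le> (\<integral>\<^sup>+\<omega>. ennreal (norm (G \<omega>) powr p) \<partial>M)" using le by simp
  finally show ?thesis .
qed

section \<open>Bounds on the two distances\<close>

definition W_pow :: "real \<Rightarrow> (real^'n) measure \<Rightarrow> (real^'n) measure \<Rightarrow> ennreal" where
  "W_pow p P Q = (INF \<pi>\<in>Cpl P Q. \<integral>\<^sup>+z. ennreal (norm (fst z - snd z) powr p) \<partial>\<pi>)"

lemma wasserstein_dist_W_pow: "wasserstein_dist p P Q = enn2real (W_pow p P Q) powr (1 / p)"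
  by (simp add: wasserstein_dist_def W_pow_def)

lemma W_pow_le_distr:
  fixes X Y :: "'a \<Rightarrow> real^'n"
  assumes "prob_space M" and [measurable]: "X \<in> borel_measurable M" "Y \<in> borel_measurable M"
  shows "W_pow p (distr M borel X) (distr M borel Y) \<le> (\<integral>\<^sup>+\<omega>. ennreal (norm (X \<omega> - Y \<omega>) powr p) \<partial>M)"
proof -
  have [measurable]: "(\<lambda>\<omega>. (X \<omega>, Y \<omega>)) \<in> borel_measurable M" by (intro borel_measurable_Pair) auto
  have "W_pow p (distr M borel X) (distr M borel Y)
     \<le> (\<integral>\<^sup>+z. ennreal (norm (fst z - snd z) powr p) \<partial>distr M borel (\<lambda>\<omega>. (X \<omega>, Y \<omega>)))"
    unfolding W_pow_def by (rule INF_lower[OF coupling_of_pair]) (use assms in auto)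
  also have "\<dots> = (\<integral>\<^sup>+\<omega>. ennreal (norm (X \<omega> - Y \<omega>) powr p) \<partial>M)"
    by (subst nn_integral_distr) auto
  finally show ?thesis .
qed

lemma finite_moment_prob_space: "P \<in> finite_moment_measures p \<Longrightarrow> prob_space P"
  and finite_moment_sets: "P \<in> finite_moment_measures p \<Longrightarrow> sets P = sets borel"
  and finite_moment_integrable: "P \<in> finite_moment_measures p \<Longrightarrow> integrable P (\<lambda>x. norm x powr p)"
  by (auto simp: finite_moment_measures_def)

lemma finite_moment_integrable_ident:
  fixes P :: "(real^'n) measure"
  assumes P: "P \<in> finite_moment_measures p" and p: "1 \<le> p"
  shows "integrable P (\<lambda>x. x)"
proof -
  interpret prob_space P using P by (rule finite_moment_prob_space)
  have [simp, measurable_cong]: "sets P = sets borel" using P by (rule finite_moment_sets)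
  show ?thesis
    by (rule Bochner_Integration.integrable_bound[where f = "\<lambda>x. 1 + norm x powr p"])
      (use finite_moment_integrable[OF P] powr_le_one_plus[OF _ p] in \<open>auto simp: abs_of_nonneg\<close>)
qed

lemma Cpl_integrable:
  fixes f :: "real^'n \<Rightarrow> 'c::{banach, second_countable_topology}"
  assumes \<pi>: "\<pi> \<in> Cpl P Q" and [measurable]: "f \<in> borel_measurable borel"
  shows "integrable P f \<Longrightarrow> integrable \<pi> (\<lambda>z. f (fst z))" "integrable Q f \<Longrightarrow> integrable \<pi> (\<lambda>z. f (snd z))"
proof -
  have [measurable_cong]: "sets \<pi> = sets borel" using \<pi> by (rule Cpl_sets)
  have PQ: "P = distr \<pi> borel fst" "Q = distr \<pi> borel snd" using \<pi> by (auto simp: Cpl_def)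
  show "integrable P f \<Longrightarrow> integrable \<pi> (\<lambda>z. f (fst z))" unfolding PQ by (subst (asm) integrable_distr_eq) auto
  show "integrable Q f \<Longrightarrow> integrable \<pi> (\<lambda>z. f (snd z))" unfolding PQ by (subst (asm) integrable_distr_eq) auto
qed

lemma Cpl_moment_integrable:
  fixes P Q :: "(real^'n) measure"
  assumes P: "P \<in> finite_moment_measures p" and Q: "Q \<in> finite_moment_measures p" and p: "1 \<le> p"
    and \<pi>: "\<pi> \<in> Cpl P Q"
  shows "integrable \<pi> fst" "integrable \<pi> snd"
proof -
  have m: "(\<lambda>x. x) \<in> borel_measurable (borel :: (real^'n) measure)" by simp
  show "integrable \<pi> fst" "integrable \<pi> snd"
    using Cpl_integrable(1)[OF \<pi> m finite_moment_integrable_ident[OF P p]]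
      Cpl_integrable(2)[OF \<pi> m finite_moment_integrable_ident[OF Q p]] by simp_all
qed

text \<open>
  The displacement \<open>X - Y\<close> is a drift of every coupling.
\<close>

lemma V_pow_le_W_pow:
  fixes P Q :: "(real^'n) measure"
  assumes P: "P \<in> finite_moment_measures p" and Q: "Q \<in> finite_moment_measures p" and p: "1 \<le> p"
  shows "V_pow p P Q \<le> W_pow p P Q"
  unfolding W_pow_def
proof (rule INF_greatest)
  fix \<pi> assume \<pi>: "\<pi> \<in> Cpl P Q"
  note int = Cpl_moment_integrable[OF P Q p \<pi>]
  have "V_pow p (distr \<pi> borel fst) (distr \<pi> borel snd) \<le> (\<integral>\<^sup>+z. ennreal (norm (fst z - snd z) powr p) \<partial>\<pi>)"
    using int by (intro V_pow_le_drift drift_self Cpl_prob[OF \<pi>] p)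
  then show "V_pow p P Q \<le> (\<integral>\<^sup>+z. ennreal (norm (fst z - snd z) powr p) \<partial>\<pi>)"
    using \<pi> by (simp add: Cpl_def)
qed

text \<open>
  A density with respect to the product measure defines a coupling as soon as its sections integrate
  to \<open>1\<close>. The product coupling, the glued couplings and the partition couplings arise in this way.
\<close>

lemma distr_fst_density:
  fixes P :: "'a measure" and Q :: "'b measure"
  assumes "prob_space P" "prob_space Q" and h[measurable]: "h \<in> borel_measurable (P \<Otimes>\<^sub>M Q)"
    and sec: "AE x in P. (\<integral>\<^sup>+y. h (x, y) \<partial>Q) = 1" and N: "sets N = sets P"
  shows "distr (density (P \<Otimes>\<^sub>M Q) h) N fst = P"
proof (rule measure_eqI)
  interpret P: prob_space P by fact
  interpret Q: prob_space Q by fact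
  note [measurable_cong] = N
  fix A assume "A \<in> sets (distr (density (P \<Otimes>\<^sub>M Q) h) N fst)"
  then have A[measurable]: "A \<in> sets P" using N by simp
  have "emeasure (distr (density (P \<Otimes>\<^sub>M Q) h) N fst) A
      = (\<integral>\<^sup>+z. h z * indicator A (fst z) \<partial>(P \<Otimes>\<^sub>M Q))"
    using N by (subst emeasure_distr) (auto simp: emeasure_density space_pair_measure indicator_def
        intro!: nn_integral_cong)
  also have "\<dots> = (\<integral>\<^sup>+x. (\<integral>\<^sup>+y. h (x, y) * indicator A x \<partial>Q) \<partial>P)"
    by (subst Q.nn_integral_fst[symmetric]) auto
  also have "\<dots> = (\<integral>\<^sup>+x. (\<integral>\<^sup>+y. h (x, y) \<partial>Q) * indicator A x \<partial>P)"
    by (intro nn_integral_cong nn_integral_multc) measurable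
  also have "\<dots> = (\<integral>\<^sup>+x. indicator A x \<partial>P)"
    using sec by (intro nn_integral_cong_AE) auto
  finally show "emeasure (distr (density (P \<Otimes>\<^sub>M Q) h) N fst) A = emeasure P A" by simp
qed (use N in simp)

lemma distr_snd_density:
  fixes P :: "'a measure" and Q :: "'b measure"
  assumes "prob_space P" "prob_space Q" and h[measurable]: "h \<in> borel_measurable (P \<Otimes>\<^sub>M Q)"
    and sec: "AE y in Q. (\<integral>\<^sup>+x. h (x, y) \<partial>P) = 1" and N: "sets N = sets Q"
  shows "distr (density (P \<Otimes>\<^sub>M Q) h) N snd = Q"
proof (rule measure_eqI)
  interpret P: prob_space P by fact
  interpret Q: prob_space Q by fact
  interpret PQ: pair_sigma_finite P Q ..
  note [measurable_cong] = N
  fix A assume "A \<in> sets (distr (density (P \<Otimes>\<^sub>M Q) h) N snd)"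
  then have A[measurable]: "A \<in> sets Q" using N by simp
  have "emeasure (distr (density (P \<Otimes>\<^sub>M Q) h) N snd) A
      = (\<integral>\<^sup>+z. h z * indicator A (snd z) \<partial>(P \<Otimes>\<^sub>M Q))"
    using N by (subst emeasure_distr) (auto simp: emeasure_density space_pair_measure indicator_def
        intro!: nn_integral_cong)
  also have "\<dots> = (\<integral>\<^sup>+y. (\<integral>\<^sup>+x. h (x, y) * indicator A y \<partial>P) \<partial>Q)"
    by (subst PQ.nn_integral_snd[symmetric]) auto
  also have "\<dots> = (\<integral>\<^sup>+y. (\<integral>\<^sup>+x. h (x, y) \<partial>P) * indicator A y \<partial>Q)"
    by (intro nn_integral_cong nn_integral_multc) measurable
  also have "\<dots> = (\<integral>\<^sup>+y. indicator A y \<partial>Q)"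
    using sec by (intro nn_integral_cong_AE) auto
  finally show "emeasure (distr (density (P \<Otimes>\<^sub>M Q) h) N snd) A = emeasure Q A" by simp
qed (use N in simp)

lemma W_pow_finite:
  fixes P Q :: "(real^'n) measure"
  assumes P: "P \<in> finite_moment_measures p" and Q: "Q \<in> finite_moment_measures p" and p: "1 \<le> p"
  shows "W_pow p P Q < \<infinity>"
proof -
  interpret P: prob_space P using P by (rule finite_moment_prob_space)
  interpret Q: prob_space Q using Q by (rule finite_moment_prob_space)
  define M where "M = density (P \<Otimes>\<^sub>M Q) (\<lambda>_. 1)"
  have [simp, measurable_cong]: "sets P = sets borel" "sets Q = sets borel"
    using P Q by (auto dest: finite_moment_sets)
  have [measurable_cong]: "sets M = sets (borel \<Otimes>\<^sub>M borel)"
    unfolding M_def sets_density by (intro sets_pair_measure_cong) auto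
  have marg: "distr M borel fst = P" "distr M borel snd = Q"
    unfolding M_def
    by (auto intro!: distr_fst_density distr_snd_density P.prob_space_axioms Q.prob_space_axioms
        simp: P.emeasure_space_1 Q.emeasure_space_1)
  have M: "prob_space M"
    by (rule prob_space_distrD[of fst M borel]) (auto simp: marg intro: P.prob_space_axioms)
  have "W_pow p P Q \<le> (\<integral>\<^sup>+\<omega>. ennreal (norm (fst \<omega> - snd \<omega>) powr p) \<partial>M)"
    using W_pow_le_distr[OF M, of fst snd p] by (simp add: marg)
  also have "\<dots> \<le> (\<integral>\<^sup>+\<omega>. ennreal (2 powr p * (norm (fst \<omega>) powr p + norm (snd \<omega>) powr p)) \<partial>M)"
    by (intro nn_integral_mono ennreal_leI norm_diff_powr_le p)
  also have "\<dots> < \<infinity>"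
  proof -
    have "integrable (distr M borel fst) (\<lambda>x. norm x powr p)" "integrable (distr M borel snd) (\<lambda>x. norm x powr p)"
      unfolding marg using finite_moment_integrable P Q by auto
    then have "integrable M (\<lambda>\<omega>. 2 powr p * (norm (fst \<omega>) powr p + norm (snd \<omega>) powr p))"
      by (subst (asm) (1 2) integrable_distr_eq) auto
    then show ?thesis by (subst nn_integral_eq_integral) auto
  qed
  finally show ?thesis .
qed

lemma root_less_imp_less:
  assumes "v < (\<infinity>::ennreal)" "enn2real v powr (1 / p) < a" "1 \<le> p"
  shows "v < ennreal (a powr p)"
proof -
  have "enn2real v = (enn2real v powr (1 / p)) powr p" using assms by (simp add: powr_powr)
  also have "\<dots> < a powr p" using assms by (intro powr_less_mono2) auto
  finally have "ennreal (enn2real v) < ennreal (a powr p)" by (rule ennreal_lessI[rotated]) (use assms in \<open>auto intro: le_less_trans\<close>)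
  then show ?thesis using assms by simp
qed

lemma le_imp_root_le:
  assumes "v \<le> ennreal (a powr p)" "0 \<le> a" "1 \<le> p"
  shows "enn2real v powr (1 / p) \<le> a"
proof -
  have "enn2real v \<le> a powr p" using assms by (simp add: enn2real_leI)
  then have "enn2real v powr (1 / p) \<le> (a powr p) powr (1 / p)" using assms by (intro powr_mono2) auto
  then show ?thesis using assms by (simp add: powr_powr)
qed

lemma wasserstein_dist_le:
  fixes X Y :: "'a \<Rightarrow> real^'n"
  assumes "prob_space M" "X \<in> borel_measurable M" "Y \<in> borel_measurable M" "1 \<le> p" "0 \<le> a"
    and "(\<integral>\<^sup>+\<omega>. ennreal (norm (X \<omega> - Y \<omega>) powr p) \<partial>M) \<le> ennreal (a powr p)"
  shows "wasserstein_dist p (distr M borel X) (distr M borel Y) \<le> a"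
  unfolding wasserstein_dist_W_pow
  by (rule le_imp_root_le[OF order_trans[OF W_pow_le_distr[OF assms(1-3)] assms(6)] assms(5,4)])

lemma V_le_drift:
  fixes X Y G :: "'a \<Rightarrow> real^'n"
  assumes "prob_space M" "drift M X Y G" "1 \<le> p" "0 \<le> a"
    and "(\<integral>\<^sup>+\<omega>. ennreal (norm (G \<omega>) powr p) \<partial>M) \<le> ennreal (a powr p)"
  shows "V p (distr M borel X) (distr M borel Y) \<le> a"
  unfolding V_def
  by (rule le_imp_root_le[OF order_trans[OF V_pow_le_drift[OF assms(1-3)] assms(5)] assms(4,3)])

lemma wasserstein_dist_less_obtain:
  fixes P Q :: "(real^'n) measure"
  assumes "P \<in> finite_moment_measures p" "Q \<in> finite_moment_measures p" "1 \<le> p"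
    and "wasserstein_dist p P Q < a"
  obtains \<pi> where "\<pi> \<in> Cpl P Q" "(\<integral>\<^sup>+z. ennreal (norm (fst z - snd z) powr p) \<partial>\<pi>) \<le> ennreal (a powr p)"
proof -
  have "W_pow p P Q < ennreal (a powr p)"
    using W_pow_finite[OF assms(1-3)] assms(3,4) unfolding wasserstein_dist_W_pow
    by (intro root_less_imp_less)
  then show thesis using that unfolding W_pow_def INF_less_iff by (auto intro: less_imp_le)
qed

lemma V_less_obtain:
  fixes P Q :: "(real^'n) measure"
  assumes P: "P \<in> finite_moment_measures p" and Q: "Q \<in> finite_moment_measures p" and p: "1 \<le> p"
    and less: "V p P Q < a"
  obtains \<pi> G where "\<pi> \<in> Cpl P Q" "drift \<pi> fst snd G"
    "(\<integral>\<^sup>+z. ennreal (norm (G z) powr p) \<partial>\<pi>) \<le> ennreal (a powr p)"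
proof -
  have "V_pow p P Q < \<infinity>"
    using V_pow_le_W_pow[OF P Q p] W_pow_finite[OF P Q p] by (rule le_less_trans)
  then have "V_pow p P Q < ennreal (a powr p)"
    using less p unfolding V_def by (rule root_less_imp_less)
  then obtain \<pi> where \<pi>: "\<pi> \<in> Cpl P Q"
    and le: "(\<integral>\<^sup>+z. ennreal (norm (vec_cond_exp \<pi> (sigma_fst \<pi>) (\<lambda>w. fst w - snd w) z) powr p) \<partial>\<pi>) < ennreal (a powr p)"
    unfolding V_pow_def INF_less_iff by blast
  note int = Cpl_moment_integrable[OF P Q p \<pi>]
  show thesis
    by (rule that[OF \<pi> drift_vec_cond_exp(2)[OF \<pi> int] less_imp_le[OF le]])
qed

lemma V_le_wasserstein_dist:
  fixes P Q :: "(real^'n) measure"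
  assumes "P \<in> finite_moment_measures p" "Q \<in> finite_moment_measures p" "1 \<le> p"
  shows "V p P Q \<le> wasserstein_dist p P Q"
  unfolding V_def wasserstein_dist_W_pow
proof (rule powr_mono2)
  show "enn2real (V_pow p P Q) \<le> enn2real (W_pow p P Q)"
    using V_pow_le_W_pow[OF assms] W_pow_finite[OF assms] by (intro enn2real_mono) auto
qed (use assms in auto)

lemma wasserstein_dist_commute:
  fixes P Q :: "(real^'n) measure"
  shows "wasserstein_dist p P Q = wasserstein_dist p Q P"
proof -
  have le: "W_pow p P Q \<le> W_pow p Q P" for P Q :: "(real^'n) measure"
    unfolding W_pow_def[of p Q P]
  proof (rule INF_greatest)
    fix \<pi> assume \<pi>: "\<pi> \<in> Cpl Q P"
    have [measurable_cong]: "sets \<pi> = sets borel" using \<pi> by (rule Cpl_sets)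
    have "distr \<pi> borel fst = Q" "distr \<pi> borel snd = P" using \<pi> by (auto simp: Cpl_def)
    then show "W_pow p P Q \<le> (\<integral>\<^sup>+z. ennreal (norm (fst z - snd z) powr p) \<partial>\<pi>)"
      using W_pow_le_distr[OF Cpl_prob[OF \<pi>], of snd fst p] by (simp add: norm_minus_commute)
  qed
  have "W_pow p P Q = W_pow p Q P" by (intro antisym le)
  then show ?thesis by (simp add: wasserstein_dist_W_pow)
qed

section \<open>Approximate gluing and the triangle inequalities\<close>

text \<open>
  The cells are the fibres of \<open>J\<close>. With a dense sequence \<open>c\<close>, a point belongs to the cell of the first
  \<open>c k\<close> that is closer than \<open>\<delta> / 2\<close>.
\<close>

lemma small_cells:
  fixes \<delta> :: real assumes "0 < \<delta>"
  obtains J :: "'b::euclidean_space \<Rightarrow> nat"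
  where "J \<in> measurable borel (count_space UNIV)" "\<And>y y'. J y = J y' \<Longrightarrow> dist y y' \<le> \<delta>"
proof -
  obtain D :: "'b set" where D: "countable D" and dense: "\<And>X. open X \<Longrightarrow> X \<noteq> {} \<Longrightarrow> \<exists>d\<in>D. d \<in> X"
    using countable_dense_setE by blast
  define c where "c = from_nat_into D"
  define J where "J y = (LEAST k. dist y (c k) < \<delta> / 2)" for y
  have close: "dist y (c (J y)) < \<delta> / 2" for y
  proof -
    obtain d where "d \<in> D" "d \<in> ball y (\<delta> / 2)" using dense[of "ball y (\<delta> / 2)"] assms by auto
    moreover then obtain k where "c k = d"
      using from_nat_into_surj[OF D] unfolding c_def by blast
    ultimately have "dist y (c k) < \<delta> / 2" by simp
    then show ?thesis unfolding J_def by (rule LeastI)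
  qed
  show thesis
  proof
    show "J \<in> measurable borel (count_space UNIV)"
      unfolding J_def by (intro measurable_Least) simp
    show "dist y y' \<le> \<delta>" if "J y = J y'" for y y'
      using close[of y] close[of y'] that dist_triangle2[of y y' "c (J y)"] by simp
  qed
qed

text \<open>
  Draw \<open>(x, y)\<close> from \<open>\<pi>1\<close> and then \<open>(y', z)\<close> from \<open>\<pi>2\<close> conditioned on \<open>y'\<close> lying in the cell of \<open>y\<close>. The
  joint law has density \<open>1 / Q(cell)\<close> on the set where the two cells agree. Since \<open>y\<close> and \<open>y'\<close> both have
  law \<open>Q\<close>, the marginals are \<open>\<pi>1\<close> and \<open>\<pi>2\<close>. Given \<open>(x, y)\<close>, the law of \<open>(y', z)\<close> is \<open>\<pi>2\<close> conditioned
  on an event determined by \<open>y'\<close>; hence a function of \<open>(y', z)\<close> that is centred given \<open>y'\<close> stays centred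
  given \<open>x\<close>, which is the last property.
\<close>

lemma gluing:
  fixes P Q R :: "(real^'n) measure" and \<delta> :: real
  assumes \<pi>1: "\<pi>1 \<in> Cpl P Q" and \<pi>2: "\<pi>2 \<in> Cpl Q R" and \<delta>: "0 < \<delta>"
  obtains M :: "(((real^'n) \<times> (real^'n)) \<times> ((real^'n) \<times> (real^'n))) measure"
  where "prob_space M" "sets M = sets borel" "distr M borel fst = \<pi>1" "distr M borel snd = \<pi>2"
    "AE w in M. norm (snd (fst w) - fst (snd w)) \<le> \<delta>"
    "\<And>A (f :: (real^'n) \<times> (real^'n) \<Rightarrow> real^'n). A \<in> sets borel \<Longrightarrow> integrable \<pi>2 f \<Longrightarrow>
       (\<And>B. B \<in> sets borel \<Longrightarrow> (\<integral>z. indicator B (fst z) *\<^sub>R f z \<partial>\<pi>2) = 0) \<Longrightarrow>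
       (\<integral>w. indicator A (fst (fst w)) *\<^sub>R f (snd w) \<partial>M) = 0"
proof -
  interpret p1: prob_space \<pi>1 using \<pi>1 by (rule Cpl_prob)
  interpret p2: prob_space \<pi>2 using \<pi>2 by (rule Cpl_prob)
  interpret pp: pair_sigma_finite \<pi>1 \<pi>2 ..
  have s1[simp]: "sets \<pi>1 = sets borel" using \<pi>1 by (rule Cpl_sets)
  have s2[simp]: "sets \<pi>2 = sets borel" using \<pi>2 by (rule Cpl_sets)
  have [measurable_cong]: "sets \<pi>1 = sets (borel \<Otimes>\<^sub>M borel)" "sets \<pi>2 = sets (borel \<Otimes>\<^sub>M borel)"
    unfolding borel_prod by (rule s1 s2)+
  have Q: "Q = distr \<pi>1 borel snd" "Q = distr \<pi>2 borel fst" using \<pi>1 \<pi>2 by (auto simp: Cpl_def)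
  have Qp: "prob_space Q" unfolding Q(1) by (rule p1.prob_space_distr) simp
  interpret Q: prob_space Q by (rule Qp)
  have sQ[measurable_cong]: "sets Q = sets borel" by (simp add: Q)
  obtain J :: "real^'n \<Rightarrow> nat" where J[measurable]: "J \<in> measurable borel (count_space UNIV)"
    and Jd: "\<And>y y'. J y = J y' \<Longrightarrow> dist y y' \<le> \<delta>" using small_cells[OF \<delta>] by blast
  define q where "q j = measure Q {y. J y = j}" for j
  have cell[measurable]: "{y. J y = j} \<in> sets borel" for j by measurable
  define h where "h w = (if J (snd (fst w)) = J (fst (snd w)) then 1 / q (J (snd (fst w))) else 0)"
    for w :: "((real^'n) \<times> (real^'n)) \<times> ((real^'n) \<times> (real^'n))"
  have h0: "0 \<le> h w" for w by (simp add: h_def q_def)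
  have hm[measurable]: "h \<in> borel_measurable (\<pi>1 \<Otimes>\<^sub>M \<pi>2)"
  proof -
    have J1: "(\<lambda>w. J (snd (fst w))) \<in> measurable (\<pi>1 \<Otimes>\<^sub>M \<pi>2) (count_space UNIV)"
      and [measurable]: "(\<lambda>w. J (fst (snd w))) \<in> measurable (\<pi>1 \<Otimes>\<^sub>M \<pi>2) (count_space UNIV)"
      by measurable
    have q1: "(\<lambda>w. 1 / q (J (snd (fst w)))) \<in> borel_measurable (\<pi>1 \<Otimes>\<^sub>M \<pi>2)"
      using measurable_compose[OF J1, of "\<lambda>j. 1 / q j"] by simp
    note [measurable] = J1
    have "{w \<in> space (\<pi>1 \<Otimes>\<^sub>M \<pi>2). \<exists>n. J (snd (fst w)) = n \<and> J (fst (snd w)) = n} \<in> sets (\<pi>1 \<Otimes>\<^sub>M \<pi>2)"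
      by measurable
    then have "{w \<in> space (\<pi>1 \<Otimes>\<^sub>M \<pi>2). J (snd (fst w)) = J (fst (snd w))} \<in> sets (\<pi>1 \<Otimes>\<^sub>M \<pi>2)"
      by (rule back_subst[where P = "\<lambda>S. S \<in> sets (\<pi>1 \<Otimes>\<^sub>M \<pi>2)"]) auto
    from measurable_If[OF q1 borel_measurable_const this] show ?thesis unfolding h_def .
  qed
  \<comment> \<open>Only countably many cells exist, so almost every point lies in a cell of positive mass.\<close>
  have charged: "AE y in Q. q (J y) \<noteq> 0"
  proof -
    have "AE y in Q. q j = 0 \<longrightarrow> J y \<noteq> j" for j
    proof (cases "q j = 0")
      case True
      then have "{y. J y = j} \<in> null_sets Q"
        by (intro null_setsI) (auto simp: q_def Q.emeasure_eq_measure sQ)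
      then show ?thesis using AE_not_in by fastforce
    qed simp
    then have "AE y in Q. \<forall>j. q j = 0 \<longrightarrow> J y \<noteq> j" by (simp add: AE_all_countable)
    then show ?thesis by eventually_elim auto
  qed
  have mass: "(\<integral>\<^sup>+y. ennreal (if J y = j then 1 / q j else 0) \<partial>Q) = 1" if "q j \<noteq> 0" for j
  proof -
    have "(\<integral>\<^sup>+y. ennreal (if J y = j then 1 / q j else 0) \<partial>Q) = (\<integral>\<^sup>+y. ennreal (1 / q j) * indicator {y. J y = j} y \<partial>Q)"
      by (intro nn_integral_cong) (auto simp: indicator_def)
    also have "\<dots> = ennreal (1 / q j) * emeasure Q {y. J y = j}"
      by (rule nn_integral_cmult_indicator) (simp add: sQ)
    also have "\<dots> = ennreal (1 / q j * q j)"
      unfolding Q.emeasure_eq_measure q_def[symmetric] by (rule ennreal_mult[symmetric]) (auto simp: q_def)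
    finally show ?thesis using that by simp
  qed
  define M where "M = density (\<pi>1 \<Otimes>\<^sub>M \<pi>2) (\<lambda>w. ennreal (h w))"
  have sM[measurable_cong]: "sets M = sets borel"
  proof -
    have "sets M = sets (borel \<Otimes>\<^sub>M borel)" unfolding M_def sets_density by (intro sets_pair_measure_cong s1 s2)
    then show ?thesis unfolding borel_prod .
  qed
  have m1: "distr M borel fst = \<pi>1" unfolding M_def
  proof (rule distr_fst_density)
    have "AE w in \<pi>1. q (J (snd w)) \<noteq> 0"
      using charged unfolding Q(1) by (subst (asm) AE_distr_iff) auto
    then show "AE w in \<pi>1. (\<integral>\<^sup>+z. ennreal (h (w, z)) \<partial>\<pi>2) = 1"
    proof eventually_elim
      case (elim w)
      have "(\<integral>\<^sup>+z. ennreal (h (w, z)) \<partial>\<pi>2)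
         = (\<integral>\<^sup>+y. ennreal (if J y = J (snd w) then 1 / q (J (snd w)) else 0) \<partial>Q)"
        unfolding Q(2) by (subst nn_integral_distr) (auto simp: h_def intro!: nn_integral_cong)
      then show ?case using mass[OF elim] by simp
    qed
  qed (auto intro: p1.prob_space_axioms p2.prob_space_axioms)
  have m2: "distr M borel snd = \<pi>2" unfolding M_def
  proof (rule distr_snd_density)
    have "AE z in \<pi>2. q (J (fst z)) \<noteq> 0"
      using charged unfolding Q(2) by (subst (asm) AE_distr_iff) auto
    then show "AE z in \<pi>2. (\<integral>\<^sup>+w. ennreal (h (w, z)) \<partial>\<pi>1) = 1"
    proof eventually_elim
      case (elim z)
      have "(\<integral>\<^sup>+w. ennreal (h (w, z)) \<partial>\<pi>1)
         = (\<integral>\<^sup>+y. ennreal (if J y = J (fst z) then 1 / q (J (fst z)) else 0) \<partial>Q)"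
        unfolding Q(1) by (subst nn_integral_distr) (auto simp: h_def intro!: nn_integral_cong)
      then show ?case using mass[OF elim] by simp
    qed
  qed (auto intro: p1.prob_space_axioms p2.prob_space_axioms)
  have fstm: "fst \<in> measurable M borel" and sndm: "snd \<in> measurable M borel"
    unfolding measurable_cong_sets[OF sM refl]
    by (auto intro!: borel_measurable_continuous_onI continuous_intros)
  have pM: "prob_space M"
    by (rule prob_space_distrD[OF fstm]) (simp add: m1 p1.prob_space_axioms)
  show thesis
  proof (rule that[of M])
    show "AE w in M. norm (snd (fst w) - fst (snd w)) \<le> \<delta>"
    proof -
      have "(\<lambda>w. ennreal (h w)) \<in> borel_measurable (\<pi>1 \<Otimes>\<^sub>M \<pi>2)" by measurable
      then show ?thesis unfolding M_def
        by (subst AE_density) (use Jd in \<open>auto simp: h_def dist_norm\<close>)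
    qed
  next
    fix A :: "(real^'n) set" and f :: "(real^'n) \<times> (real^'n) \<Rightarrow> real^'n"
    assume A[measurable]: "A \<in> sets borel" and f: "integrable \<pi>2 f"
      and zero: "\<And>B. B \<in> sets borel \<Longrightarrow> (\<integral>z. indicator B (fst z) *\<^sub>R f z \<partial>\<pi>2) = 0"
    have fm: "f \<in> borel_measurable borel" using f by (auto dest!: borel_measurable_integrable simp: measurable_cong_sets[OF s2 refl])
    have gm: "(\<lambda>w. indicator A (fst (fst w)) *\<^sub>R f (snd w)) \<in> borel_measurable (\<pi>1 \<Otimes>\<^sub>M \<pi>2)"
    proof -
      have [measurable]: "(\<lambda>w. f (snd w)) \<in> borel_measurable (\<pi>1 \<Otimes>\<^sub>M \<pi>2)"
        by (rule measurable_compose[OF measurable_snd borel_measurable_integrable[OF f]])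
      show ?thesis by measurable
    qed
    have sMp: "sets M = sets (\<pi>1 \<Otimes>\<^sub>M \<pi>2)" unfolding M_def by (rule sets_density)
    have gM: "(\<lambda>w. indicator A (fst (fst w)) *\<^sub>R f (snd w)) \<in> borel_measurable M"
      unfolding measurable_cong_sets[OF sMp refl] by (rule gm)
    have "integrable M (\<lambda>w. f (snd w))"
      using f unfolding m2[symmetric] by (subst (asm) integrable_distr_eq[OF sndm fm]) auto
    then have int: "integrable M (\<lambda>w. indicator A (fst (fst w)) *\<^sub>R f (snd w))"
      using gM by (rule Bochner_Integration.integrable_bound) (auto simp: indicator_def)
    have "(\<integral>w. indicator A (fst (fst w)) *\<^sub>R f (snd w) \<partial>M)
        = (\<integral>w. h w *\<^sub>R indicator A (fst (fst w)) *\<^sub>R f (snd w) \<partial>(\<pi>1 \<Otimes>\<^sub>M \<pi>2))"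
      unfolding M_def by (rule integral_density) (use h0 gm in auto)
    also have "\<dots> = (\<integral>u. \<integral>z. h (u, z) *\<^sub>R indicator A (fst u) *\<^sub>R f z \<partial>\<pi>2 \<partial>\<pi>1)"
    proof -
      have "integrable (\<pi>1 \<Otimes>\<^sub>M \<pi>2) (\<lambda>w. h w *\<^sub>R indicator A (fst (fst w)) *\<^sub>R f (snd w))"
        using int unfolding M_def by (subst (asm) integrable_density) (use h0 gm in auto)
      from pp.integral_fst'[OF this] show ?thesis by simp
    qed
    also have "\<dots> = 0"
    proof -
      have "(\<integral>z. h (u, z) *\<^sub>R indicator A (fst u) *\<^sub>R f z \<partial>\<pi>2) = 0" for u
      proof -
        have "(\<integral>z. h (u, z) *\<^sub>R indicator A (fst u) *\<^sub>R f z \<partial>\<pi>2)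
          = (\<integral>z. (indicator A (fst u) / q (J (snd u))) *\<^sub>R (indicator {y. J y = J (snd u)} (fst z) *\<^sub>R f z) \<partial>\<pi>2)"
          by (intro Bochner_Integration.integral_cong) (auto simp: h_def indicator_def)
        also have "\<dots> = (indicator A (fst u) / q (J (snd u))) *\<^sub>R (\<integral>z. indicator {y. J y = J (snd u)} (fst z) *\<^sub>R f z \<partial>\<pi>2)"
          by (rule integral_scaleR_right)
        finally show ?thesis using zero[OF cell] by simp
      qed
      then show ?thesis by simp
    qed
    finally show "(\<integral>w. indicator A (fst (fst w)) *\<^sub>R f (snd w) \<partial>M) = 0" .
  qed (use pM sM m1 m2 in auto)
qed

lemma minkowski3_le:
  fixes F G H :: "'a \<Rightarrow> 'b::euclidean_space"
  assumes [measurable]: "F \<in> borel_measurable M" "G \<in> borel_measurable M" "H \<in> borel_measurable M"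
    and pos: "0 < a" "0 < b" "0 < c" and p: "1 \<le> p"
    and F: "(\<integral>\<^sup>+x. ennreal (norm (F x) powr p) \<partial>M) \<le> ennreal (a powr p)"
    and G: "(\<integral>\<^sup>+x. ennreal (norm (G x) powr p) \<partial>M) \<le> ennreal (b powr p)"
    and H: "(\<integral>\<^sup>+x. ennreal (norm (H x) powr p) \<partial>M) \<le> ennreal (c powr p)"
  shows "(\<integral>\<^sup>+x. ennreal (norm (F x + G x + H x) powr p) \<partial>M) \<le> ennreal ((a + b + c) powr p)"
proof -
  have "(\<integral>\<^sup>+x. ennreal (norm (F x + G x + H x) powr p) \<partial>M)
    \<le> (\<integral>\<^sup>+x. ennreal ((norm (F x) + norm (G x) + norm (H x)) powr p) \<partial>M)"
    using p by (intro nn_integral_mono ennreal_leI powr_mono2 order_trans[OF norm_triangle_ineq]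
        add_right_mono norm_triangle_ineq) auto
  also have "\<dots> \<le> ennreal ((a + b + c) powr p)"
    by (intro minkowski_le[OF _ _ _ _ _ _ p minkowski_le[OF _ _ _ _ _ _ p F G] H]) (use pos in auto)
  finally show ?thesis .
qed

lemma nn_integral_glued:
  assumes "distr M borel fst = \<pi>1" "distr M borel snd = \<pi>2" and sM: "sets M = sets borel"
    and f: "f \<in> borel_measurable (borel :: ((real^'n) \<times> (real^'n)) measure)"
  shows "(\<integral>\<^sup>+w. f (fst w) \<partial>M) = (\<integral>\<^sup>+z. f z \<partial>\<pi>1)" "(\<integral>\<^sup>+w. f (snd w) \<partial>M) = (\<integral>\<^sup>+z. f z \<partial>\<pi>2)"
proof -
  have "fst \<in> measurable M borel" "snd \<in> measurable M borel"
    unfolding measurable_cong_sets[OF sM refl]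
    by (auto intro!: borel_measurable_continuous_onI continuous_intros)
  then show "(\<integral>\<^sup>+w. f (fst w) \<partial>M) = (\<integral>\<^sup>+z. f z \<partial>\<pi>1)" "(\<integral>\<^sup>+w. f (snd w) \<partial>M) = (\<integral>\<^sup>+z. f z \<partial>\<pi>2)"
    using f unfolding assms(1,2)[symmetric] by (simp_all add: nn_integral_distr)
qed

text \<open>
  Turns bounds from nearly optimal couplings, glued up to \<open>\<delta>\<close>, into a triangle inequality.
\<close>

lemma le_add_of_all_greater:
  fixes a b c :: real
  assumes "\<And>\<alpha> \<beta> \<delta>. a < \<alpha> \<Longrightarrow> b < \<beta> \<Longrightarrow> 0 < \<delta> \<Longrightarrow> c \<le> \<alpha> + \<delta> + \<beta>"
  shows "c \<le> a + b"
proof (rule field_le_epsilon)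
  fix e :: real assume "0 < e"
  then show "c \<le> a + b + e" using assms[of "a + e / 3" "b + e / 3" "e / 3"] by simp
qed

lemma V_nonneg: "0 \<le> V p P Q" by (simp add: V_def)
lemma wasserstein_dist_nonneg: "0 \<le> wasserstein_dist p P Q" by (simp add: wasserstein_dist_def)

text \<open>
  The result of gluing, with the data needed to estimate displacements on the glued space.
\<close>

locale glued =
  fixes M :: "(((real^'n) \<times> (real^'n)) \<times> ((real^'n) \<times> (real^'n))) measure"
    and \<pi>1 \<pi>2 P Q R and p \<delta> :: real
  assumes P: "P \<in> finite_moment_measures p" and Q: "Q \<in> finite_moment_measures p"
    and R: "R \<in> finite_moment_measures p" and p: "1 \<le> p"
    and \<pi>1: "\<pi>1 \<in> Cpl P Q" and \<pi>2: "\<pi>2 \<in> Cpl Q R" and \<delta>: "0 < \<delta>"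
    and M: "prob_space M" and sM: "sets M = sets borel"
    and m1: "distr M borel fst = \<pi>1" and m2: "distr M borel snd = \<pi>2"
    and near: "AE w in M. norm (snd (fst w) - fst (snd w)) \<le> \<delta>"
begin

lemma proj_measurable:
  "fst \<in> measurable M borel" "snd \<in> measurable M borel"
  unfolding measurable_cong_sets[OF sM refl]
  by (auto intro!: borel_measurable_continuous_onI continuous_intros)

lemma measurable_first: "f \<in> measurable borel N \<Longrightarrow> (\<lambda>w. f (fst w)) \<in> measurable M N"
  and measurable_second: "f \<in> measurable borel N \<Longrightarrow> (\<lambda>w. f (snd w)) \<in> measurable M N"
  using measurable_compose[OF proj_measurable(1)] measurable_compose[OF proj_measurable(2)] by auto

lemma marginals:
  "distr M borel (\<lambda>w. fst (fst w)) = P" "distr M borel (\<lambda>w. snd (snd w)) = R"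
proof -
  have "distr (distr M borel fst) borel fst = distr M borel (fst \<circ> fst)"
    by (rule distr_distr[OF _ proj_measurable(1)]) simp
  then show "distr M borel (\<lambda>w. fst (fst w)) = P" using \<pi>1 by (simp add: m1 Cpl_def comp_def)
  have "distr (distr M borel snd) borel snd = distr M borel (snd \<circ> snd)"
    by (rule distr_distr[OF _ proj_measurable(2)]) simp
  then show "distr M borel (\<lambda>w. snd (snd w)) = R" using \<pi>2 by (simp add: m2 Cpl_def comp_def)
qed

lemma integrable_first: "integrable \<pi>1 f \<Longrightarrow> integrable M (\<lambda>w. f (fst w))"
  for f :: "_ \<Rightarrow> real^'n"
proof -
  assume f: "integrable \<pi>1 f"
  then have "f \<in> borel_measurable borel"
    using measurable_cong_sets[OF Cpl_sets[OF \<pi>1] refl] by (auto dest!: borel_measurable_integrable)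
  then show ?thesis using f unfolding m1[symmetric] by (subst (asm) integrable_distr_eq) (auto intro: proj_measurable)
qed

lemma integrable_second: "integrable \<pi>2 f \<Longrightarrow> integrable M (\<lambda>w. f (snd w))"
  for f :: "_ \<Rightarrow> real^'n"
proof -
  assume f: "integrable \<pi>2 f"
  then have "f \<in> borel_measurable borel"
    using measurable_cong_sets[OF Cpl_sets[OF \<pi>2] refl] by (auto dest!: borel_measurable_integrable)
  then show ?thesis using f unfolding m2[symmetric] by (subst (asm) integrable_distr_eq) (auto intro: proj_measurable)
qed

lemma sum_norm_le:
  fixes F G :: "(real^'n) \<times> (real^'n) \<Rightarrow> real^'n"
  assumes F: "F \<in> borel_measurable borel" "(\<integral>\<^sup>+z. ennreal (norm (F z) powr p) \<partial>\<pi>1) \<le> ennreal (a powr p)"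
    and G: "G \<in> borel_measurable borel" "(\<integral>\<^sup>+z. ennreal (norm (G z) powr p) \<partial>\<pi>2) \<le> ennreal (b powr p)"
    and pos: "0 < a" "0 < b"
  shows "(\<integral>\<^sup>+w. ennreal (norm (F (fst w) + (snd (fst w) - fst (snd w)) + G (snd w)) powr p) \<partial>M)
    \<le> ennreal ((a + \<delta> + b) powr p)"
proof -
  interpret prob_space M by (rule M)
  have mm: "(\<lambda>w. snd (fst w) - fst (snd w)) \<in> borel_measurable M"
    by (intro borel_measurable_diff measurable_first measurable_second) auto
  have "(\<integral>\<^sup>+w. ennreal (norm (snd (fst w) - fst (snd w)) powr p) \<partial>M) \<le> (\<integral>\<^sup>+w. ennreal (\<delta> powr p) \<partial>M)"
    using near p by (intro nn_integral_mono_AE) (auto elim!: eventually_mono intro!: ennreal_leI powr_mono2)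
  then have mid: "(\<integral>\<^sup>+w. ennreal (norm (snd (fst w) - fst (snd w)) powr p) \<partial>M) \<le> ennreal (\<delta> powr p)"
    by (simp add: emeasure_space_1)
  have "(\<lambda>z. ennreal (norm (F z) powr p)) \<in> borel_measurable borel" using F(1) by measurable
  from nn_integral_glued(1)[OF m1 m2 sM this] F(2)
  have 1: "(\<integral>\<^sup>+w. ennreal (norm (F (fst w)) powr p) \<partial>M) \<le> ennreal (a powr p)" by simp
  have "(\<lambda>z. ennreal (norm (G z) powr p)) \<in> borel_measurable borel" using G(1) by measurable
  from nn_integral_glued(2)[OF m1 m2 sM this] G(2)
  have 2: "(\<integral>\<^sup>+w. ennreal (norm (G (snd w)) powr p) \<partial>M) \<le> ennreal (b powr p)" by simp
  show ?thesis
    by (rule minkowski3_le[OF measurable_first[OF F(1)] mm measurable_second[OF G(1)] pos(1) \<delta> pos(2) p 1 mid 2])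
qed

end

lemma wasserstein_dist_triangle:
  fixes P Q R :: "(real^'n) measure"
  assumes P: "P \<in> finite_moment_measures p" and Q: "Q \<in> finite_moment_measures p"
    and R: "R \<in> finite_moment_measures p" and p: "1 \<le> p"
  shows "wasserstein_dist p P R \<le> wasserstein_dist p P Q + wasserstein_dist p Q R"
proof (rule le_add_of_all_greater)
  fix a b \<delta> :: real
  assume a: "wasserstein_dist p P Q < a" and b: "wasserstein_dist p Q R < b" and \<delta>: "0 < \<delta>"
  obtain \<pi>1 where C1: "\<pi>1 \<in> Cpl P Q" "(\<integral>\<^sup>+z. ennreal (norm (fst z - snd z) powr p) \<partial>\<pi>1) \<le> ennreal (a powr p)"
    by (rule wasserstein_dist_less_obtain[OF P Q p a])
  obtain \<pi>2 where C2: "\<pi>2 \<in> Cpl Q R" "(\<integral>\<^sup>+z. ennreal (norm (fst z - snd z) powr p) \<partial>\<pi>2) \<le> ennreal (b powr p)"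
    by (rule wasserstein_dist_less_obtain[OF Q R p b])
  obtain M where M: "prob_space M" "sets M = sets borel" "distr M borel fst = \<pi>1" "distr M borel snd = \<pi>2"
    "AE w in M. norm (snd (fst w) - fst (snd w)) \<le> \<delta>"
    by (rule gluing[OF C1(1) C2(1) \<delta>])
  interpret glued M \<pi>1 \<pi>2 P Q R p \<delta>
    using P Q R p C1(1) C2(1) \<delta> M by (intro glued.intro)
  have pos: "0 < a" "0 < b" using a b wasserstein_dist_nonneg by (auto intro: le_less_trans)
  have "wasserstein_dist p (distr M borel (\<lambda>w. fst (fst w))) (distr M borel (\<lambda>w. snd (snd w))) \<le> a + \<delta> + b"
  proof (rule wasserstein_dist_le[OF M(1) _ _ p])
    have "(\<integral>\<^sup>+w. ennreal (norm ((fst (fst w) - snd (fst w)) + (snd (fst w) - fst (snd w)) + (fst (snd w) - snd (snd w))) powr p) \<partial>M)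
      \<le> ennreal ((a + \<delta> + b) powr p)"
      by (rule sum_norm_le[OF _ C1(2) _ C2(2) pos]) simp_all
    then show "(\<integral>\<^sup>+w. ennreal (norm (fst (fst w) - snd (snd w)) powr p) \<partial>M) \<le> ennreal ((a + \<delta> + b) powr p)"
      by simp
  qed (use pos \<delta> measurable_first[of fst] measurable_second[of snd] in auto)
  then show "wasserstein_dist p P R \<le> a + \<delta> + b" by (simp add: marginals)
qed

lemma V_triangle:
  fixes P Q R :: "(real^'n) measure"
  assumes P: "P \<in> finite_moment_measures p" and Q: "Q \<in> finite_moment_measures p"
    and R: "R \<in> finite_moment_measures p" and p: "1 \<le> p"
  shows "V p P R \<le> V p P Q + V p Q R"
proof (rule le_add_of_all_greater)
  fix a b \<delta> :: real
  assume a: "V p P Q < a" and b: "V p Q R < b" and \<delta>: "0 < \<delta>"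
  obtain \<pi>1 F where C1: "\<pi>1 \<in> Cpl P Q" and dF: "drift \<pi>1 fst snd F"
    and nF: "(\<integral>\<^sup>+z. ennreal (norm (F z) powr p) \<partial>\<pi>1) \<le> ennreal (a powr p)"
    by (rule V_less_obtain[OF P Q p a])
  obtain \<pi>2 G where C2: "\<pi>2 \<in> Cpl Q R" and dG: "drift \<pi>2 fst snd G"
    and nG: "(\<integral>\<^sup>+z. ennreal (norm (G z) powr p) \<partial>\<pi>2) \<le> ennreal (b powr p)"
    by (rule V_less_obtain[OF Q R p b])
  obtain M where M: "prob_space M" "sets M = sets borel" "distr M borel fst = \<pi>1" "distr M borel snd = \<pi>2"
    "AE w in M. norm (snd (fst w) - fst (snd w)) \<le> \<delta>"
    and zero: "\<And>A (f :: (real^'n) \<times> (real^'n) \<Rightarrow> real^'n). A \<in> sets borel \<Longrightarrow> integrable \<pi>2 f \<Longrightarrow>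
       (\<And>B. B \<in> sets borel \<Longrightarrow> (\<integral>z. indicator B (fst z) *\<^sub>R f z \<partial>\<pi>2) = 0) \<Longrightarrow>
       (\<integral>w. indicator A (fst (fst w)) *\<^sub>R f (snd w) \<partial>M) = 0"
    by (rule gluing[OF C1(1) C2(1) \<delta>]) blast
  interpret glued M \<pi>1 \<pi>2 P Q R p \<delta>
    using P Q R p C1(1) C2(1) \<delta> M by (intro glued.intro)
  have pos: "0 < a" "0 < b" using a b V_nonneg by (auto intro: le_less_trans)
  have F: "integrable \<pi>1 fst" "integrable \<pi>1 snd" "integrable \<pi>1 F"
    and G: "integrable \<pi>2 fst" "integrable \<pi>2 snd" "integrable \<pi>2 G"
    using dF dG by (auto simp: drift_def)
  have Fm: "F \<in> borel_measurable borel" and Gm: "G \<in> borel_measurable borel"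
    using F(3) G(3) measurable_cong_sets[OF Cpl_sets[OF C1] refl] measurable_cong_sets[OF Cpl_sets[OF C2] refl]
    by (auto dest!: borel_measurable_integrable)
  define D1 where "D1 z = fst z - snd z - F z" for z
  define D2 where "D2 z = fst z - snd z - G z" for z
  have D1i: "integrable \<pi>1 D1" and D2i: "integrable \<pi>2 D2"
    unfolding D1_def D2_def using F G by auto
  have D1m: "D1 \<in> borel_measurable borel" unfolding D1_def using Fm by measurable
  let ?K = "\<lambda>w. F (fst w) + (snd (fst w) - fst (snd w)) + G (snd w)"
  have "V p (distr M borel (\<lambda>w. fst (fst w))) (distr M borel (\<lambda>w. snd (snd w))) \<le> a + \<delta> + b"
  proof (rule V_le_drift[OF M(1) _ p, where G = ?K])
    have "(\<integral>w. indicator A (fst (fst w)) *\<^sub>R (fst (fst w) - snd (snd w) - ?K w) \<partial>M) = 0"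
      if A: "A \<in> sets borel" for A
    proof -
      have ind: "integrable M (\<lambda>w. indicator A (fst (fst w)) *\<^sub>R f w)" if "integrable M f" for f :: "_ \<Rightarrow> real^'n"
      proof -
        have "(\<lambda>w. fst (fst w)) \<in> measurable M borel" by (rule measurable_first) simp
        then have "(\<lambda>w. fst (fst w)) -` A \<inter> space M \<in> sets M" using A by (rule measurable_sets)
        from integrable_mult_indicator[OF this that] show ?thesis
          by (rule Bochner_Integration.integrable_cong[THEN iffD1, rotated 2]) (auto simp: indicator_def)
      qed
      have "(\<integral>z. indicator A (fst z) *\<^sub>R D1 z \<partial>distr M borel fst) = 0"
        using dF A unfolding m1 D1_def by (simp add: drift_def)
      then have 1: "(\<integral>w. indicator A (fst (fst w)) *\<^sub>R D1 (fst w) \<partial>M) = 0"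
        using D1m A by (subst (asm) integral_distr) (auto intro: proj_measurable)
      have 2: "(\<integral>w. indicator A (fst (fst w)) *\<^sub>R D2 (snd w) \<partial>M) = 0"
        using dG by (intro zero[OF A D2i]) (auto simp: drift_def D2_def)
      have "(\<integral>w. indicator A (fst (fst w)) *\<^sub>R (fst (fst w) - snd (snd w) - ?K w) \<partial>M)
        = (\<integral>w. indicator A (fst (fst w)) *\<^sub>R D1 (fst w) + indicator A (fst (fst w)) *\<^sub>R D2 (snd w) \<partial>M)"
        by (intro Bochner_Integration.integral_cong) (auto simp: D1_def D2_def algebra_simps)
      also have "\<dots> = 0"
        using 1 2 ind integrable_first[OF D1i] integrable_second[OF D2i]
        by (subst Bochner_Integration.integral_add) auto
      finally show ?thesis .
    qed
    then show "drift M (\<lambda>w. fst (fst w)) (\<lambda>w. snd (snd w)) ?K"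
      using integrable_first[OF F(1)] integrable_first[OF F(2)] integrable_first[OF F(3)]
        integrable_second[OF G(1)] integrable_second[OF G(2)] integrable_second[OF G(3)]
      by (auto simp: drift_def)
  qed (use pos \<delta> sum_norm_le[OF Fm nF Gm nG pos] in auto)
  then show "V p P R \<le> a + \<delta> + b" by (simp add: marginals)
qed

section \<open>Integrals of differences of convex functions\<close>

text \<open>
  The field \<open>w\<close> consists of subgradients of \<open>f\<close>, so \<open>f\<close> is convex and \<open>L\<close>-Lipschitz. A measurable choice of
  subgradients is part of the definition because \<open>w(X)\<close> is paired with drifts.
\<close>

definition convex_test :: "real \<Rightarrow> ('b::euclidean_space \<Rightarrow> real) \<Rightarrow> bool" where
  "convex_test L f \<longleftrightarrow> f \<in> borel_measurable borel \<and>
     (\<exists>w\<in>borel_measurable borel. \<forall>x. norm (w x) \<le> L \<and> (\<forall>y. f x + w x \<bullet> (y - x) \<le> f y))"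

lemma convex_testI:
  assumes "f \<in> borel_measurable borel" "w \<in> borel_measurable borel" "\<And>x. norm (w x) \<le> L"
    "\<And>x y. f x + w x \<bullet> (y - x) \<le> f y"
  shows "convex_test L f"
  unfolding convex_test_def using assms by blast

lemma convex_testE:
  assumes "convex_test L f"
  obtains w where "f \<in> borel_measurable borel" "w \<in> borel_measurable borel" "\<And>x. norm (w x) \<le> L"
    "\<And>x y. f x + w x \<bullet> (y - x) \<le> f y"
  using assms unfolding convex_test_def by blast

lemma convex_test_nonneg: "convex_test L f \<Longrightarrow> 0 \<le> L"
  by (elim convex_testE) (meson norm_ge_zero order_trans)

lemma convex_test_const: "convex_test 0 (\<lambda>_. c)"
  by (rule convex_testI[where w = "\<lambda>_. 0"]) auto

lemma convex_test_norm: "convex_test 1 (\<lambda>x::'b::euclidean_space. norm (x - a))"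
proof (rule convex_testI[where w = "\<lambda>x. sgn (x - a)"])
  show "(\<lambda>x. sgn (x - a)) \<in> borel_measurable borel" unfolding sgn_div_norm by measurable
  show "norm (x - a) + sgn (x - a) \<bullet> (y - x) \<le> norm (y - a)" for x y
  proof -
    have "y - x = (y - a) - (x - a)" by simp
    then show ?thesis
      using excess_powr_above_tangent[of 0 1 "x - a" "y - a"]
      by (cases "x = a") (simp_all add: excess_grad_def)
  qed
qed (auto simp: norm_sgn)

lemma convex_test_add:
  assumes "convex_test L f" "convex_test K g" shows "convex_test (L + K) (\<lambda>x. f x + g x)"
proof -
  obtain w where w: "f \<in> borel_measurable borel" "w \<in> borel_measurable borel" "\<And>x. norm (w x) \<le> L"
    "\<And>x y. f x + w x \<bullet> (y - x) \<le> f y" using assms(1) by (rule convex_testE) blast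
  obtain v where v: "g \<in> borel_measurable borel" "v \<in> borel_measurable borel" "\<And>x. norm (v x) \<le> K"
    "\<And>x y. g x + v x \<bullet> (y - x) \<le> g y" using assms(2) by (rule convex_testE) blast
  show ?thesis
  proof (rule convex_testI[where w = "\<lambda>x. w x + v x"])
    show "norm (w x + v x) \<le> L + K" for x
      using norm_triangle_ineq[of "w x" "v x"] w(3)[of x] v(3)[of x] by linarith
    show "f x + g x + (w x + v x) \<bullet> (y - x) \<le> f y + g y" for x y
      using w(4)[of x y] v(4)[of x y] by (simp add: inner_add_left)
  qed (use w v in auto)
qed

lemma convex_test_scale:
  assumes "convex_test L f" "0 \<le> c" shows "convex_test (c * L) (\<lambda>x. c * f x)"
proof -
  obtain w where w: "f \<in> borel_measurable borel" "w \<in> borel_measurable borel" "\<And>x. norm (w x) \<le> L"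
    "\<And>x y. f x + w x \<bullet> (y - x) \<le> f y" using assms(1) by (rule convex_testE) blast
  show ?thesis
  proof (rule convex_testI[where w = "\<lambda>x. c *\<^sub>R w x"])
    show "norm (c *\<^sub>R w x) \<le> c * L" for x using w(3)[of x] assms(2) by (simp add: mult_left_mono)
    show "c * f x + (c *\<^sub>R w x) \<bullet> (y - x) \<le> c * f y" for x y
      using mult_left_mono[OF w(4)[of x y] assms(2)] by (simp add: distrib_left)
  qed (use w in auto)
qed

lemma convex_test_max:
  assumes "convex_test L f" "convex_test K g" shows "convex_test (L + K) (\<lambda>x. max (f x) (g x))"
proof -
  have LK: "0 \<le> L" "0 \<le> K" using assms by (auto dest: convex_test_nonneg)
  obtain w where w[measurable]: "f \<in> borel_measurable borel" "w \<in> borel_measurable borel"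
    and w': "\<And>x. norm (w x) \<le> L" "\<And>x y. f x + w x \<bullet> (y - x) \<le> f y"
    using assms(1) by (rule convex_testE) blast
  obtain v where v[measurable]: "g \<in> borel_measurable borel" "v \<in> borel_measurable borel"
    and v': "\<And>x. norm (v x) \<le> K" "\<And>x y. g x + v x \<bullet> (y - x) \<le> g y"
    using assms(2) by (rule convex_testE) blast
  show ?thesis
  proof (rule convex_testI[where w = "\<lambda>x. if g x \<le> f x then w x else v x"])
    show "norm (if g x \<le> f x then w x else v x) \<le> L + K" for x
      using w'(1)[of x] v'(1)[of x] LK by auto
    show "max (f x) (g x) + (if g x \<le> f x then w x else v x) \<bullet> (y - x) \<le> max (f y) (g y)" for x y
      using w'(2)[of x y] v'(2)[of x y] by (auto simp: max_def)
  qed measurable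
qed

lemma convex_test_mono: "convex_test L f \<Longrightarrow> L \<le> K \<Longrightarrow> convex_test K f"
  using convex_test_add[OF _ convex_testI[of "\<lambda>_. 0" "\<lambda>_. 0" "K - L"], of L f] by simp

lemma convex_test_growth:
  assumes "convex_test L f" shows "\<bar>f x\<bar> \<le> \<bar>f 0\<bar> + L * norm x"
proof -
  obtain w where w: "\<And>x. norm (w x) \<le> L" "\<And>x y. f x + w x \<bullet> (y - x) \<le> f y"
    using assms by (elim convex_testE) blast
  have "\<bar>w y \<bullet> x\<bar> \<le> L * norm x" for y
    using Cauchy_Schwarz_ineq2[of "w y" x] mult_right_mono[OF w(1)[of y], of "norm x"] by simp
  from this[of 0] this[of x] show ?thesis using w(2)[of 0 x] w(2)[of x 0] by simp
qed

lemma convex_test_integrable: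
  fixes P :: "(real^'n) measure"
  assumes f: "convex_test L f" and P: "P \<in> finite_moment_measures p" and p: "1 \<le> p"
  shows "integrable P f"
proof -
  interpret prob_space P using P by (rule finite_moment_prob_space)
  have fm: "f \<in> borel_measurable P"
    using f by (simp add: convex_test_def measurable_cong_sets[OF finite_moment_sets[OF P] refl])
  show ?thesis
  proof (rule Bochner_Integration.integrable_bound[where f = "\<lambda>x. \<bar>f 0\<bar> + L * norm x"])
    show "AE x in P. norm (f x) \<le> norm (\<bar>f 0\<bar> + L * norm x)"
      using convex_test_growth[OF f] convex_test_nonneg[OF f] by (intro AE_I2) simp
  qed (use finite_moment_integrable_ident[OF P p] fm in auto)
qed

text \<open>
  Differences of convex test functions form a vector lattice; it contains bump functions, which
  are not convex themselves, and so localizes the comparison of integrals.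
\<close>

definition test_fun :: "('b::euclidean_space \<Rightarrow> real) \<Rightarrow> bool" where
  "test_fun \<phi> \<longleftrightarrow> (\<exists>L f g. convex_test L f \<and> convex_test L g \<and> \<phi> = (\<lambda>x. f x - g x))"

lemma test_funI:
  assumes "convex_test L f" "convex_test K g" "\<And>x. \<phi> x = f x - g x" shows "test_fun \<phi>"
proof -
  have "convex_test (max L K) f" "convex_test (max L K) g"
    using assms(1,2) by (auto intro: convex_test_mono)
  moreover have "\<phi> = (\<lambda>x. f x - g x)" using assms(3) by auto
  ultimately show ?thesis unfolding test_fun_def by blast
qed

lemma test_funE:
  assumes "test_fun \<phi>"
  obtains L f g where "convex_test L f" "convex_test L g" "\<And>x. \<phi> x = f x - g x"
  using assms unfolding test_fun_def by blast

lemma test_fun_convex: "convex_test L f \<Longrightarrow> test_fun f"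
  by (rule test_funI[OF _ convex_test_const[of 0]]) auto

lemma test_fun_diff:
  assumes "test_fun \<phi>" "test_fun \<psi>" shows "test_fun (\<lambda>x. \<phi> x - \<psi> x)"
proof -
  obtain L f g where f: "convex_test L f" "convex_test L g" "\<And>x. \<phi> x = f x - g x"
    using assms(1) by (rule test_funE) blast
  obtain K f' g' where g: "convex_test K f'" "convex_test K g'" "\<And>x. \<psi> x = f' x - g' x"
    using assms(2) by (rule test_funE) blast
  show ?thesis
    by (rule test_funI[OF convex_test_add[OF f(1) g(2)] convex_test_add[OF f(2) g(1)]])
      (simp add: f(3) g(3))
qed

text \<open>
  From \<open>max (f - g) (f' - g') = max (f + g') (f' + g) - (g + g')\<close>.
\<close>

lemma test_fun_max:
  assumes "test_fun \<phi>" "test_fun \<psi>" shows "test_fun (\<lambda>x. max (\<phi> x) (\<psi> x))"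
proof -
  obtain L f g where f: "convex_test L f" "convex_test L g" "\<And>x. \<phi> x = f x - g x"
    using assms(1) by (rule test_funE) blast
  obtain K f' g' where g: "convex_test K f'" "convex_test K g'" "\<And>x. \<psi> x = f' x - g' x"
    using assms(2) by (rule test_funE) blast
  show ?thesis
    by (rule test_funI[OF convex_test_max[OF convex_test_add[OF f(1) g(2)] convex_test_add[OF g(1) f(2)]]
          convex_test_add[OF f(2) g(2)]])
      (simp add: f(3) g(3) max_def)
qed

lemma test_fun_min:
  assumes "test_fun \<phi>" "test_fun \<psi>" shows "test_fun (\<lambda>x. min (\<phi> x) (\<psi> x))"
proof -
  have 0: "test_fun (\<lambda>x. 0)" by (rule test_fun_convex[OF convex_test_const])
  have "test_fun (\<lambda>x. 0 - max (0 - \<phi> x) (0 - \<psi> x))"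
    by (intro test_fun_diff test_fun_max 0 assms)
  moreover have "0 - max (0 - \<phi> x) (0 - \<psi> x) = min (\<phi> x) (\<psi> x)" for x
    by (simp add: max_def min_def)
  ultimately show ?thesis by simp
qed

lemma test_fun_measurable: "test_fun \<phi> \<Longrightarrow> \<phi> \<in> borel_measurable borel"
  by (auto simp: test_fun_def convex_test_def intro!: borel_measurable_diff)

lemma drift_sigma_fst:
  assumes \<pi>: "\<pi> \<in> Cpl P Q" and dr: "drift \<pi> fst snd G" and A: "A \<in> sets (sigma_fst \<pi>)"
  shows "(\<integral>z. indicator A z *\<^sub>R (fst z - snd z - G z) \<partial>\<pi>) = 0"
proof -
  obtain B where B: "B \<in> sets borel" "A = fst -` B \<inter> space \<pi>"
    using A by (auto simp: sigma_fst_def sets_vimage_algebra2)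
  then have "indicator A z = (indicator B (fst z) :: real)" for z
    using Cpl_space[OF \<pi>] by (auto simp: indicator_def)
  then show ?thesis using dr B(1) by (simp add: drift_def)
qed

lemma fst_measurable_sigma_fst: "fst \<in> measurable (sigma_fst \<pi>) borel"
  unfolding sigma_fst_def by (rule measurable_vimage_algebra1) simp

text \<open>
  Let \<open>G\<close> be a drift of a coupling of \<open>P\<close> and \<open>Q\<close>. Write the subgradient inequality
  \<open>f(X) \<le> f(Y) + w(X) \<bullet> (X - Y)\<close>. In the mean, \<open>X - Y\<close> may be replaced by \<open>G\<close>, because \<open>w(X)\<close> is a
  bounded function of \<open>X\<close>, and the mean of \<open>\<parallel>G\<parallel>\<close> is at most \<open>\<parallel>G\<parallel>\<^sub>p\<close>.
\<close>

lemma integral_convex_test_le: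
  fixes P Q :: "(real^'n) measure"
  assumes P: "P \<in> finite_moment_measures p" and Q: "Q \<in> finite_moment_measures p" and p: "1 \<le> p"
    and f: "convex_test L f" and a: "V p P Q < a"
  shows "(\<integral>x. f x \<partial>P) \<le> (\<integral>x. f x \<partial>Q) + L * a"
proof -
  have apos: "0 < a" using V_nonneg a by (rule le_less_trans)
  obtain \<pi> G where \<pi>: "\<pi> \<in> Cpl P Q" and dr: "drift \<pi> fst snd G"
    and G: "(\<integral>\<^sup>+z. ennreal (norm (G z) powr p) \<partial>\<pi>) \<le> ennreal (a powr p)"
    by (rule V_less_obtain[OF P Q p a])
  interpret prob_space \<pi> using \<pi> by (rule Cpl_prob)
  have ints: "integrable \<pi> fst" "integrable \<pi> snd" "integrable \<pi> G" using dr by (auto simp: drift_def)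
  obtain w where fm: "f \<in> borel_measurable borel" and wm: "w \<in> borel_measurable borel"
    and w: "\<And>x. norm (w x) \<le> L" "\<And>x y. f x + w x \<bullet> (y - x) \<le> f y"
    using f by (rule convex_testE) blast
  let ?D = "\<lambda>z. fst z - snd z - G z"
  have Di: "integrable \<pi> ?D" using ints by auto
  have wF: "(\<lambda>z. w (fst z)) \<in> borel_measurable (sigma_fst \<pi>)"
    by (rule measurable_compose[OF fst_measurable_sigma_fst wm])
  note orth = subalgebra_orthogonal_bounded[OF prob_space_axioms subalgebra_sigma_fst[OF \<pi>] Di
      drift_sigma_fst[OF \<pi> dr] wF w(1)]
  have mean: "(\<integral>z. norm (G z) \<partial>\<pi>) \<le> a" using ints(3) by (intro mean_norm_le(2)[OF _ p apos G]) auto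
  have fP: "integrable \<pi> (\<lambda>z. f (fst z))" and fQ: "integrable \<pi> (\<lambda>z. f (snd z))"
    using Cpl_integrable[OF \<pi> fm] convex_test_integrable[OF f P p] convex_test_integrable[OF f Q p] by auto
  have ptw: "f (fst z) \<le> f (snd z) + w (fst z) \<bullet> ?D z + L * norm (G z)" for z
  proof -
    have "w (fst z) \<bullet> (snd z - fst z) = - (w (fst z) \<bullet> ?D z) - w (fst z) \<bullet> G z"
      by (simp add: inner_diff_right)
    moreover have "w (fst z) \<bullet> G z \<le> L * norm (G z)"
      using norm_cauchy_schwarz[of "w (fst z)" "G z"] mult_right_mono[OF w(1)[of "fst z"], of "norm (G z)"]
      by simp
    ultimately show ?thesis using w(2)[of "fst z" "snd z"] by linarith
  qed
  have sm: "fst \<in> measurable \<pi> borel" "snd \<in> measurable \<pi> borel" using ints by auto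
  have "(\<integral>x. f x \<partial>P) = (\<integral>z. f (fst z) \<partial>\<pi>)"
    using \<pi> integral_distr[OF sm(1) fm] by (simp add: Cpl_def)
  also have "\<dots> \<le> (\<integral>z. f (snd z) + w (fst z) \<bullet> ?D z + L * norm (G z) \<partial>\<pi>)"
    using ptw fP fQ orth ints by (intro integral_mono) auto
  also have "\<dots> = (\<integral>z. f (snd z) \<partial>\<pi>) + L * (\<integral>z. norm (G z) \<partial>\<pi>)"
    using fQ orth ints by simp
  also have "(\<integral>z. f (snd z) \<partial>\<pi>) = (\<integral>x. f x \<partial>Q)"
    using \<pi> integral_distr[OF sm(2) fm] by (simp add: Cpl_def)
  also have "L * (\<integral>z. norm (G z) \<partial>\<pi>) \<le> L * a"
    using mean convex_test_nonneg[OF f] by (rule mult_left_mono)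
  finally show ?thesis by simp
qed

lemma integral_test_fun_le:
  fixes \<phi> :: "real^'n \<Rightarrow> real"
  assumes "test_fun \<phi>"
  obtains K where "0 \<le> K" "\<And>p (P :: (real^'n) measure) Q a. P \<in> finite_moment_measures p \<Longrightarrow> Q \<in> finite_moment_measures p \<Longrightarrow>
    1 \<le> p \<Longrightarrow> V_max p P Q < a \<Longrightarrow> \<bar>(\<integral>x. \<phi> x \<partial>P) - (\<integral>x. \<phi> x \<partial>Q)\<bar> \<le> K * a"
proof -
  obtain L f g where f: "convex_test L f" and g: "convex_test L g" and \<phi>: "\<And>x. \<phi> x = f x - g x"
    using assms by (rule test_funE) blast
  show thesis
  proof (rule that[of "2 * L"])
    fix p a and P Q :: "(real^'n) measure"
    assume P: "P \<in> finite_moment_measures p" and Q: "Q \<in> finite_moment_measures p" and p: "1 \<le> p"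
      and "V_max p P Q < a"
    then have a: "V p P Q < a" "V p Q P < a" by (auto simp: V_max_def)
    have int: "(\<integral>x. \<phi> x \<partial>P) = (\<integral>x. f x \<partial>P) - (\<integral>x. g x \<partial>P)" "(\<integral>x. \<phi> x \<partial>Q) = (\<integral>x. f x \<partial>Q) - (\<integral>x. g x \<partial>Q)"
      unfolding \<phi> using convex_test_integrable[OF f _ p] convex_test_integrable[OF g _ p] P Q by simp_all
    show "\<bar>(\<integral>x. \<phi> x \<partial>P) - (\<integral>x. \<phi> x \<partial>Q)\<bar> \<le> 2 * L * a"
      using integral_convex_test_le[OF P Q p f a(1)] integral_convex_test_le[OF P Q p g a(1)]
        integral_convex_test_le[OF Q P p f a(2)] integral_convex_test_le[OF Q P p g a(2)]
      unfolding int by linarith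
  qed (use convex_test_nonneg[OF f] in auto)
qed

section \<open>Tails and partitions of unity\<close>

text \<open>
  In a coupling with \<open>X\<close> of law \<open>Q\<close> and \<open>Y\<close> of law \<open>P\<close>, the vector \<open>X\<close> is the conditional expectation of
  \<open>Y + G\<close> given \<open>X\<close>. Jensen's inequality and \<open>(\<parallel>Y + G\<parallel> - R)\<^sub>+ \<le> (\<parallel>Y\<parallel> - R)\<^sub>+ + \<parallel>G\<parallel>\<close> give the bound.
\<close>

lemma tail_transfer:
  fixes P Q :: "(real^'n) measure"
  assumes P: "P \<in> finite_moment_measures p" and Q: "Q \<in> finite_moment_measures p" and p: "1 \<le> p"
    and a: "V p Q P < a" and \<kappa>: "0 < \<kappa>" and R: "0 \<le> R"
    and tail: "(\<integral>\<^sup>+x. ennreal (excess R x powr p) \<partial>P) \<le> ennreal (\<kappa> powr p)"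
  shows "(\<integral>\<^sup>+x. ennreal (excess R x powr p) \<partial>Q) \<le> ennreal ((\<kappa> + a) powr p)"
proof -
  have apos: "0 < a" using V_nonneg a by (rule le_less_trans)
  obtain \<pi> G where \<pi>: "\<pi> \<in> Cpl Q P" and dr: "drift \<pi> fst snd G"
    and G: "(\<integral>\<^sup>+z. ennreal (norm (G z) powr p) \<partial>\<pi>) \<le> ennreal (a powr p)"
    by (rule V_less_obtain[OF Q P p a])
  interpret prob_space \<pi> using \<pi> by (rule Cpl_prob)
  have ints: "integrable \<pi> fst" "integrable \<pi> snd" "integrable \<pi> G" using dr by (auto simp: drift_def)
  then have sm[measurable]: "fst \<in> measurable \<pi> borel" "snd \<in> measurable \<pi> borel" "G \<in> measurable \<pi> borel" by auto
  have marg: "distr \<pi> borel fst = Q" "distr \<pi> borel snd = P" using \<pi> by (auto simp: Cpl_def)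
  have em: "(\<lambda>x. ennreal (excess R x powr p)) \<in> borel_measurable (borel :: (real^'n) measure)" by measurable
  have "(\<integral>\<^sup>+x. ennreal (excess R x powr p) \<partial>Q) = (\<integral>\<^sup>+z. ennreal (excess R (fst z) powr p) \<partial>\<pi>)"
    unfolding marg(1)[symmetric] by (rule nn_integral_distr) (use em in auto)
  also have "\<dots> \<le> (\<integral>\<^sup>+z. ennreal (excess R (snd z + G z) powr p) \<partial>\<pi>)"
  proof (rule conditional_jensen_excess[OF prob_space_axioms subalgebra_sigma_fst[OF \<pi>] fst_measurable_sigma_fst ints(1) _ _ R p])
    fix A assume "A \<in> sets (sigma_fst \<pi>)"
    then have "(\<integral>z. - (indicator A z *\<^sub>R (fst z - snd z - G z)) \<partial>\<pi>) = 0"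
      using drift_sigma_fst[OF \<pi> dr] by simp
    moreover have "- (indicator A z *\<^sub>R (fst z - snd z - G z)) = indicator A z *\<^sub>R (snd z + G z - fst z)" for z
      by (simp add: algebra_simps)
    ultimately show "(\<integral>z. indicator A z *\<^sub>R (snd z + G z - fst z) \<partial>\<pi>) = 0" by simp
  qed (use ints in auto)
  also have "\<dots> \<le> (\<integral>\<^sup>+z. ennreal ((excess R (snd z) + norm (G z)) powr p) \<partial>\<pi>)"
  proof (intro nn_integral_mono ennreal_leI powr_mono2)
    show "excess R (snd z + G z) \<le> excess R (snd z) + norm (G z)" for z
      using norm_triangle_ineq[of "snd z" "G z"] by (auto simp: excess_def)
  qed (use p in auto)
  also have "\<dots> \<le> ennreal ((\<kappa> + a) powr p)"
  proof (rule minkowski_le[OF _ _ _ _ \<kappa> apos p _ G])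
    have "(\<integral>\<^sup>+z. ennreal (excess R (snd z) powr p) \<partial>\<pi>) = (\<integral>\<^sup>+x. ennreal (excess R x powr p) \<partial>P)"
      unfolding marg(2)[symmetric] by (rule nn_integral_distr[symmetric]) (use em in auto)
    then show "(\<integral>\<^sup>+z. ennreal (excess R (snd z) powr p) \<partial>\<pi>) \<le> ennreal (\<kappa> powr p)" using tail by simp
  qed auto
  finally show ?thesis .
qed

lemma tail_small:
  fixes P :: "(real^'n) measure"
  assumes P: "P \<in> finite_moment_measures p" and p: "1 \<le> p" and \<kappa>: "0 < \<kappa>"
  obtains R where "0 < R" "(\<integral>\<^sup>+x. ennreal (excess R x powr p) \<partial>P) \<le> ennreal (\<kappa> powr p)"
proof -
  interpret prob_space P using P by (rule finite_moment_prob_space)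
  have [measurable_cong]: "sets P = sets borel" using P by (rule finite_moment_sets)
  have dom: "norm (excess (real n) x powr p) \<le> norm x powr p" for n and x :: "real^'n"
    using p by (auto simp: excess_def intro!: powr_mono2)
  have lim: "(\<lambda>n. excess (real n) x powr p) \<longlonglongrightarrow> 0" for x :: "real^'n"
  proof (rule tendsto_eventually)
    obtain N where "norm x \<le> real N" using real_arch_simple by blast
    then show "eventually (\<lambda>n. excess (real n) x powr p = 0) sequentially"
      by (intro eventually_sequentiallyI[of N]) (auto simp: excess_def)
  qed
  have "(\<lambda>n. \<integral>x. excess (real n) x powr p \<partial>P) \<longlonglongrightarrow> (\<integral>x. 0 \<partial>P)"
    by (rule integral_dominated_convergence[where w = "\<lambda>x. norm x powr p"])
      (use finite_moment_integrable[OF P] lim dom in auto)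
  then have "eventually (\<lambda>n. (\<integral>x. excess (real n) x powr p \<partial>P) < \<kappa> powr p) sequentially"
    using \<kappa> by (intro order_tendstoD(2)) auto
  then obtain n where "\<And>m. n \<le> m \<Longrightarrow> (\<integral>x. excess (real m) x powr p \<partial>P) < \<kappa> powr p"
    by (auto simp: eventually_sequentially)
  from this[of "Suc n"] have n: "(\<integral>x. excess (real (Suc n)) x powr p \<partial>P) < \<kappa> powr p" by simp
  have "integrable P (\<lambda>x. excess (real (Suc n)) x powr p)"
    by (rule Bochner_Integration.integrable_bound[OF finite_moment_integrable[OF P]]) (use dom[of "Suc n"] in auto)
  then have "(\<integral>\<^sup>+x. ennreal (excess (real (Suc n)) x powr p) \<partial>P) = ennreal (\<integral>x. excess (real (Suc n)) x powr p \<partial>P)"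
    by (rule nn_integral_eq_integral) auto
  also have "\<dots> \<le> ennreal (\<kappa> powr p)" using n by (intro ennreal_leI) simp
  finally show thesis by (intro that[of "real (Suc n)"]) auto
qed

definition tent :: "real \<Rightarrow> 'b::euclidean_space \<Rightarrow> 'b \<Rightarrow> real" where
  "tent \<eta> a x = min 1 (max 0 (2 - norm (x - a) / \<eta>))"

lemma test_fun_tent: assumes "0 < \<eta>" shows "test_fun (tent \<eta> a)"
proof -
  have c: "test_fun (\<lambda>x. c)" for c by (rule test_fun_convex[OF convex_test_const])
  have "test_fun (\<lambda>x. (1 / \<eta>) * norm (x - a))"
    using assms by (intro test_fun_convex[OF convex_test_scale[OF convex_test_norm]]) simp
  then have "test_fun (\<lambda>x. min 1 (max 0 (2 - (1 / \<eta>) * norm (x - a))))"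
    by (intro test_fun_min test_fun_max test_fun_diff c)
  then show ?thesis by (simp add: tent_def[abs_def])
qed

text \<open>
  Products of test functions are in general not test functions, so the tents around a finite net are not
  normalized. Instead let \<open>m k\<close> be the maximum of the first \<open>k\<close> tents and take the increments of \<open>m\<close>: they
  are test functions, each is supported in the corresponding tent, and their sum telescopes to the
  maximum of all tents, which is \<open>1\<close> wherever the net is \<open>\<eta>\<close>-dense.
\<close>

lemma partition_of_unity:
  fixes \<eta> S :: real
  assumes \<eta>: "0 < \<eta>"
  obtains N and \<phi> :: "nat \<Rightarrow> 'b::euclidean_space \<Rightarrow> real" where
    "\<And>k. test_fun (\<phi> k)" "\<And>k x. 0 \<le> \<phi> k x" "\<And>x. (\<Sum>k<N. \<phi> k x) \<le> 1"
    "\<And>x. norm x \<le> S \<Longrightarrow> (\<Sum>k<N. \<phi> k x) = 1"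
    "\<And>k x y. 0 < \<phi> k x \<Longrightarrow> 0 < \<phi> k y \<Longrightarrow> norm (x - y) \<le> 4 * \<eta>"
    "\<And>k x. k < N \<Longrightarrow> 0 < \<phi> k x \<Longrightarrow> norm x \<le> S + 2 * \<eta>"
proof -
  obtain C :: "'b set" where C: "finite C" "C \<subseteq> cball 0 S" "cball 0 S \<subseteq> (\<Union>c\<in>C. ball c \<eta>)"
    using seq_compact_imp_totally_bounded[of "cball (0::'b) S"] compact_cball \<eta>
    unfolding compact_eq_seq_compact_metric by blast
  define N where "N = card C"
  obtain c where c: "bij_betw c {0..<N} C" using ex_bij_betw_nat_finite[OF C(1)] unfolding N_def by blast
  define m where "m = rec_nat (\<lambda>_. 0) (\<lambda>k mk x. max (mk x) (tent \<eta> (c k) x))"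
  have m0: "m 0 = (\<lambda>_. 0)" and mS: "m (Suc k) = (\<lambda>x. max (m k x) (tent \<eta> (c k) x))" for k
    by (simp_all add: m_def)
  have tent01: "0 \<le> tent \<eta> a x" "tent \<eta> a x \<le> 1" for a x :: 'b by (auto simp: tent_def)
  have m01: "0 \<le> m k x \<and> m k x \<le> 1" for k x
    by (induction k) (auto simp: m0 mS tent01 max_def)
  have mtest: "test_fun (m k)" for k
    by (induction k) (auto simp: m0 mS intro!: test_fun_max test_fun_tent[OF \<eta>]
        test_fun_convex[OF convex_test_const])
  have mge: "tent \<eta> (c k) x \<le> m j x" if "k < j" for k j x
    using that by (induction j) (auto simp: mS less_Suc_eq le_max_iff_disj)
  define \<phi> where "\<phi> k x = m (Suc k) x - m k x" for k x
  have sum: "(\<Sum>k<n. \<phi> k x) = m n x" for n x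
    unfolding \<phi>_def by (subst sum_lessThan_telescope) (simp add: m0)
  have supp: "norm (x - c k) \<le> 2 * \<eta>" if "0 < \<phi> k x" for k x
  proof -
    have "0 < tent \<eta> (c k) x" using that m01[of k x] by (auto simp: \<phi>_def mS max_def split: if_splits)
    moreover have "2 < norm (x - c k) / \<eta>" if "\<not> ?thesis"
      using that \<eta> by (simp add: pos_less_divide_eq)
    ultimately show ?thesis by (fastforce simp: tent_def)
  qed
  show thesis
  proof (rule that[of \<phi> N])
    show "test_fun (\<phi> k)" for k unfolding \<phi>_def by (intro test_fun_diff mtest)
    show "0 \<le> \<phi> k x" for k x by (simp add: \<phi>_def mS)
    show "(\<Sum>k<N. \<phi> k x) \<le> 1" for x using m01 by (simp add: sum)
    show "(\<Sum>k<N. \<phi> k x) = 1" if x: "norm x \<le> S" for x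
    proof -
      obtain a where "a \<in> C" "x \<in> ball a \<eta>" using C(3) x by auto
      then obtain k where k: "k < N" "dist (c k) x < \<eta>"
        using c by (auto simp: bij_betw_def)
      then have "tent \<eta> (c k) x = 1" using \<eta> by (auto simp: tent_def dist_norm norm_minus_commute field_simps)
      then show ?thesis using mge[OF k(1), of x] m01[of N x] by (simp add: sum)
    qed
    show "norm (x - y) \<le> 4 * \<eta>" if "0 < \<phi> k x" "0 < \<phi> k y" for k x y
      using supp[OF that(1)] supp[OF that(2)] norm_triangle_ineq4[of "x - c k" "y - c k"] by simp
    show "norm x \<le> S + 2 * \<eta>" if "k < N" "0 < \<phi> k x" for k x
    proof -
      have "c k \<in> C" using c that(1) by (auto simp: bij_betw_def)
      then have "norm (c k) \<le> S" using C(2) by auto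
      then show ?thesis using supp[OF that(2)] norm_triangle_sub[of x "c k"] by linarith
    qed
  qed
qed

section \<open>Coupling along a partition of unity\<close>

lemma weighted_sum_integral:
  fixes \<phi> :: "nat \<Rightarrow> 'a \<Rightarrow> real"
  assumes "\<And>k. k < N \<Longrightarrow> integrable M (\<phi> k)"
  shows "integrable M (\<lambda>x. \<Sum>k<N. c k * \<phi> k x)"
    "(\<integral>x. (\<Sum>k<N. c k * \<phi> k x) \<partial>M) = (\<Sum>k<N. c k * (\<integral>x. \<phi> k x \<partial>M))"
proof -
  have int: "integrable M (\<lambda>x. c k * \<phi> k x)" if "k \<in> {..<N}" for k
    using assms that by (intro integrable_mult_right) simp
  show "integrable M (\<lambda>x. \<Sum>k<N. c k * \<phi> k x)" using int by (rule Bochner_Integration.integrable_sum)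
  have "(\<integral>x. (\<Sum>k<N. c k * \<phi> k x) \<partial>M) = (\<Sum>k<N. \<integral>x. c k * \<phi> k x \<partial>M)"
    using int by (rule Bochner_Integration.integral_sum)
  then show "(\<integral>x. (\<Sum>k<N. c k * \<phi> k x) \<partial>M) = (\<Sum>k<N. c k * (\<integral>x. \<phi> k x \<partial>M))" by simp
qed

text \<open>
  With \<open>\<mu> k = min (a k) (b k)\<close>, the coupling consists of the product measures
  \<open>\<mu> k * (\<phi> k P / a k) \<otimes> (\<phi> k Q / b k)\<close> together with the normalized product of the remainders \<open>r P\<close> and
  \<open>s Q\<close>, which have the same mass \<open>m\<close>. Mass in the first part moves by at most \<open>D\<close>; in the second part the
  displacement is bounded by the moments. If \<open>a k\<close> or \<open>b k\<close> vanishes, then \<open>\<mu> k = 0\<close> and the quotients are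
  \<open>0\<close> as they should be.
\<close>

lemma W_pow_partition_le:
  fixes P Q :: "(real^'n) measure" and \<phi> :: "nat \<Rightarrow> real^'n \<Rightarrow> real"
  assumes P: "P \<in> finite_moment_measures p" and Q: "Q \<in> finite_moment_measures p" and p: "1 \<le> p"
    and \<phi>[measurable]: "\<And>k. \<phi> k \<in> borel_measurable borel" and nn: "\<And>k x. 0 \<le> \<phi> k x"
    and le1: "\<And>x. (\<Sum>k<N. \<phi> k x) \<le> 1" and D: "0 \<le> D"
    and diam: "\<And>k x y. 0 < \<phi> k x \<Longrightarrow> 0 < \<phi> k y \<Longrightarrow> norm (x - y) \<le> D"
  defines "a \<equiv> \<lambda>k. \<integral>x. \<phi> k x \<partial>P" and "b \<equiv> \<lambda>k. \<integral>x. \<phi> k x \<partial>Q"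
  defines "r \<equiv> \<lambda>x. 1 - (\<Sum>k<N. min (a k) (b k) / a k * \<phi> k x)"
    and "s \<equiv> \<lambda>x. 1 - (\<Sum>k<N. min (a k) (b k) / b k * \<phi> k x)"
  shows "W_pow p P Q \<le> ennreal (D powr p + 2 powr p * ((\<integral>x. r x * norm x powr p \<partial>P) + (\<integral>x. s x * norm x powr p \<partial>Q)))"
proof -
  interpret P: prob_space P using P by (rule finite_moment_prob_space)
  interpret Q: prob_space Q using Q by (rule finite_moment_prob_space)
  interpret PQ: pair_sigma_finite P Q ..
  have sP[simp, measurable_cong]: "sets P = sets borel" using P by (rule finite_moment_sets)
  have sQ[simp, measurable_cong]: "sets Q = sets borel" using Q by (rule finite_moment_sets)
  define \<mu> where "\<mu> k = min (a k) (b k)" for k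
  define c where "c k = \<mu> k / (a k * b k)" for k
  define m where "m = 1 - (\<Sum>k<N. \<mu> k)"
  have le: "\<phi> k x \<le> 1" if "k < N" for k x
    using member_le_sum[of k "{..<N}" "\<lambda>k. \<phi> k x"] nn le1[of x] that by auto
  have \<phi>P: "integrable P (\<phi> k)" and \<phi>Q: "integrable Q (\<phi> k)" if "k < N" for k
    using nn le[OF that] by (auto intro!: P.integrable_const_bound[where B = 1] Q.integrable_const_bound[where B = 1])
  have a0: "0 \<le> a k" and b0: "0 \<le> b k" for k using nn by (auto simp: a_def b_def)
  have \<mu>0: "0 \<le> \<mu> k" and c0: "0 \<le> c k" for k using a0 b0 by (auto simp: \<mu>_def c_def)
  have cb: "c k * b k = \<mu> k / a k" and ca: "c k * a k = \<mu> k / b k" and cab: "c k * a k * b k = \<mu> k" for k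
    using a0[of k] b0[of k] by (auto simp: c_def \<mu>_def min_def)
  have r: "r x = 1 - (\<Sum>k<N. c k * b k * \<phi> k x)" and s: "s x = 1 - (\<Sum>k<N. c k * a k * \<phi> k x)" for x
    by (simp_all add: r_def s_def cb ca \<mu>_def)
  have cb1: "c k * b k \<le> 1" and ca1: "c k * a k \<le> 1" for k
    unfolding cb ca using a0[of k] b0[of k] by (auto simp: \<mu>_def divide_le_eq)
  have r0: "0 \<le> r x" and s0: "0 \<le> s x" for x
  proof -
    have "(\<Sum>k<N. c k * b k * \<phi> k x) \<le> (\<Sum>k<N. \<phi> k x)" "(\<Sum>k<N. c k * a k * \<phi> k x) \<le> (\<Sum>k<N. \<phi> k x)"
      using mult_right_mono[OF cb1 nn] mult_right_mono[OF ca1 nn] by (auto intro!: sum_mono)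
    then show "0 \<le> r x" "0 \<le> s x" using le1[of x] by (auto simp: r s)
  qed
  have r1: "r x \<le> 1" and s1: "s x \<le> 1" for x
    unfolding r s using nn c0 a0 b0 by (auto intro!: sum_nonneg)
  have rm[measurable]: "r \<in> borel_measurable borel" "s \<in> borel_measurable borel"
    unfolding r_def s_def by measurable
  have rP: "integrable P r" and sQi: "integrable Q s"
    using r0 r1 s0 s1 by (auto intro!: P.integrable_const_bound[where B = 1] Q.integrable_const_bound[where B = 1])
  have wP: "integrable P (\<lambda>x. \<Sum>k<N. d k * \<phi> k x)" "(\<integral>x. (\<Sum>k<N. d k * \<phi> k x) \<partial>P) = (\<Sum>k<N. d k * a k)"
    and wQ: "integrable Q (\<lambda>x. \<Sum>k<N. d k * \<phi> k x)" "(\<integral>x. (\<Sum>k<N. d k * \<phi> k x) \<partial>Q) = (\<Sum>k<N. d k * b k)" for d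
    unfolding a_def b_def by (rule weighted_sum_integral[OF \<phi>P] weighted_sum_integral[OF \<phi>Q]; simp)+
  have wP': "integrable P (\<lambda>x. \<Sum>k<N. c k * \<phi> k x * \<phi> k y)" "(\<integral>x. (\<Sum>k<N. c k * \<phi> k x * \<phi> k y) \<partial>P) = (\<Sum>k<N. c k * a k * \<phi> k y)" for y
    using wP[of "\<lambda>k. c k * \<phi> k y"] by (simp_all add: mult_ac)
  have rint: "(\<integral>x. r x \<partial>P) = m" and sint: "(\<integral>x. s x \<partial>Q) = m"
  proof -
    have "(\<integral>x. r x \<partial>P) = 1 - (\<Sum>k<N. c k * b k * a k)"
      unfolding r using wP by (simp add: P.prob_space)
    then show "(\<integral>x. r x \<partial>P) = m" using cab by (simp add: m_def mult.assoc mult.commute[of "b _"])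
    have "(\<integral>x. s x \<partial>Q) = 1 - (\<Sum>k<N. c k * a k * b k)"
      unfolding s using wQ by (simp add: Q.prob_space)
    then show "(\<integral>x. s x \<partial>Q) = m" using cab by (simp add: m_def)
  qed
  have m0: "0 \<le> m" unfolding rint[symmetric] using r0 by simp
  have \<mu>1: "(\<Sum>k<N. \<mu> k) \<le> 1" using m0 by (simp add: m_def)
  define h where "h x y = (\<Sum>k<N. c k * \<phi> k x * \<phi> k y) + r x * s y / m" for x y
  have h0: "0 \<le> h x y" for x y
    unfolding h_def using c0 nn r0 s0 m0 by (intro add_nonneg_nonneg sum_nonneg) auto
  have hm[measurable]: "(\<lambda>z. h (fst z) (snd z)) \<in> borel_measurable (P \<Otimes>\<^sub>M Q)"
    unfolding h_def by measurable
  have secx: "(\<integral>\<^sup>+y. ennreal (h x y) \<partial>Q) = ennreal (1 - r x + r x * m / m)" for x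
  proof -
    have int: "integrable Q (\<lambda>y. h x y)" unfolding h_def using wQ(1) sQi by auto
    have "(\<integral>y. h x y \<partial>Q) = (\<Sum>k<N. c k * \<phi> k x * b k) + r x * m / m"
      unfolding h_def sint[symmetric] using wQ sQi by simp
    then have "(\<integral>y. h x y \<partial>Q) = 1 - r x + r x * m / m" by (simp add: r mult_ac)
    then show ?thesis using nn_integral_eq_integral[OF int] h0 by simp
  qed
  have secy: "(\<integral>\<^sup>+x. ennreal (h x y) \<partial>P) = ennreal (1 - s y + s y * m / m)" for y
  proof -
    have int: "integrable P (\<lambda>x. h x y)" unfolding h_def using wP' rP by auto
    have "(\<integral>x. h x y \<partial>P) = (\<Sum>k<N. c k * a k * \<phi> k y) + m * s y / m"
      unfolding h_def rint[symmetric] using wP' rP by simp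
    then have "(\<integral>x. h x y \<partial>P) = 1 - s y + s y * m / m" by (simp add: s mult_ac)
    then show ?thesis using nn_integral_eq_integral[OF int] h0 by simp
  qed
  \<comment> \<open>If m = 0, there is no remainder: r vanishes P-almost everywhere and s vanishes Q-almost everywhere.\<close>
  have AEr: "AE x in P. 1 - r x + r x * m / m = 1"
  proof (cases "m = 0")
    case True
    then have "AE x in P. r x = 0"
      using integral_nonneg_eq_0_iff_AE[OF rP] r0 rint by auto
    then show ?thesis by eventually_elim simp
  qed simp
  have AEs: "AE y in Q. 1 - s y + s y * m / m = 1"
  proof (cases "m = 0")
    case True
    then have "AE x in Q. s x = 0"
      using integral_nonneg_eq_0_iff_AE[OF sQi] s0 sint by auto
    then show ?thesis by eventually_elim simp
  qed simp
  define M where "M = density (P \<Otimes>\<^sub>M Q) (\<lambda>z. ennreal (h (fst z) (snd z)))"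
  have [measurable_cong]: "sets M = sets (borel \<Otimes>\<^sub>M borel)"
    unfolding M_def sets_density by (intro sets_pair_measure_cong sP sQ)
  have marg: "distr M borel fst = P" "distr M borel snd = Q"
    unfolding M_def
  proof (rule distr_fst_density)
    show "AE x in P. (\<integral>\<^sup>+y. ennreal (h (fst (x, y)) (snd (x, y))) \<partial>Q) = 1"
      using AEr by eventually_elim (simp add: secx)
    show "distr (density (P \<Otimes>\<^sub>M Q) (\<lambda>z. ennreal (h (fst z) (snd z)))) borel snd = Q"
    proof (rule distr_snd_density)
      show "AE y in Q. (\<integral>\<^sup>+x. ennreal (h (fst (x, y)) (snd (x, y))) \<partial>P) = 1"
        using AEs by eventually_elim (simp add: secy)
    qed (auto intro: P.prob_space_axioms Q.prob_space_axioms)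
  qed (auto intro: P.prob_space_axioms Q.prob_space_axioms)
  have M: "prob_space M"
    by (rule prob_space_distrD[of fst M borel]) (auto simp: marg intro: P.prob_space_axioms)
  define Tr where "Tr = (\<integral>x. r x * norm x powr p \<partial>P)"
  define Ts where "Ts = (\<integral>x. s x * norm x powr p \<partial>Q)"
  have Tri: "integrable P (\<lambda>x. r x * norm x powr p)"
    by (rule Bochner_Integration.integrable_bound[OF finite_moment_integrable[OF P]])
      (use r0 r1 in \<open>auto simp: abs_mult abs_of_nonneg intro!: mult_left_le_one_le\<close>)
  have Tsi: "integrable Q (\<lambda>x. s x * norm x powr p)"
    by (rule Bochner_Integration.integrable_bound[OF finite_moment_integrable[OF Q]])
      (use s0 s1 in \<open>auto simp: abs_mult abs_of_nonneg intro!: mult_left_le_one_le\<close>)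
  have T0: "0 \<le> Tr" "0 \<le> Ts" unfolding Tr_def Ts_def using r0 s0 by auto
  define B where "B x y = D powr p * (\<Sum>k<N. c k * \<phi> k x * \<phi> k y)
     + 2 powr p / m * (r x * norm x powr p * s y + r x * (s y * norm y powr p))" for x y
  have hB: "h x y * norm (x - y) powr p \<le> B x y" for x y
  proof -
    have "c k * \<phi> k x * \<phi> k y * norm (x - y) powr p \<le> D powr p * (c k * \<phi> k x * \<phi> k y)" for k
    proof (cases "0 < \<phi> k x \<and> 0 < \<phi> k y")
      case True
      then have "norm (x - y) powr p \<le> D powr p" using diam[of k x y] p by (intro powr_mono2) auto
      then have "c k * \<phi> k x * \<phi> k y * norm (x - y) powr p \<le> c k * \<phi> k x * \<phi> k y * D powr p"
        using c0[of k] True by (intro mult_left_mono) auto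
      then show ?thesis by (simp add: mult_ac)
    next
      case False
      then have "\<phi> k x = 0 \<or> \<phi> k y = 0" using nn[of k x] nn[of k y] by auto
      then show ?thesis by auto
    qed
    then have 1: "(\<Sum>k<N. c k * \<phi> k x * \<phi> k y) * norm (x - y) powr p \<le> D powr p * (\<Sum>k<N. c k * \<phi> k x * \<phi> k y)"
      unfolding sum_distrib_left sum_distrib_right by (intro sum_mono)
    have "r x * s y / m * norm (x - y) powr p \<le> r x * s y / m * (2 powr p * (norm x powr p + norm y powr p))"
      using r0 s0 m0 by (intro mult_left_mono norm_diff_powr_le p) auto
    also have "\<dots> = 2 powr p / m * (r x * norm x powr p * s y + r x * (s y * norm y powr p))"
      by (simp add: field_simps add_divide_distrib)
    finally show ?thesis using 1 unfolding h_def B_def distrib_right by linarith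
  qed
  have B0: "0 \<le> B x y" for x y
    using order_trans[OF mult_nonneg_nonneg[OF h0[of x y] powr_ge_zero] hB] .
  have Bx: "(\<integral>\<^sup>+y. ennreal (B x y) \<partial>Q)
     = ennreal (D powr p * (\<Sum>k<N. c k * b k * \<phi> k x) + 2 powr p / m * (r x * norm x powr p * m + r x * Ts))" for x
  proof -
    have int: "integrable Q (\<lambda>y. B x y)" unfolding B_def using wQ(1) sQi Tsi by auto
    have "(\<integral>y. B x y \<partial>Q) = D powr p * (\<Sum>k<N. c k * \<phi> k x * b k) + 2 powr p / m * (r x * norm x powr p * m + r x * Ts)"
      unfolding B_def sint[symmetric] Ts_def using wQ sQi Tsi by simp
    then show ?thesis using nn_integral_eq_integral[OF int] B0 by (simp add: mult_ac)
  qed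
  have Bint: "(\<integral>\<^sup>+x. \<integral>\<^sup>+y. ennreal (B x y) \<partial>Q \<partial>P)
      = ennreal (D powr p * (\<Sum>k<N. c k * b k * a k) + 2 powr p / m * (Tr * m + m * Ts))"
  proof -
    let ?g = "\<lambda>x. D powr p * (\<Sum>k<N. c k * b k * \<phi> k x) + 2 powr p / m * (r x * norm x powr p * m + r x * Ts)"
    have int: "integrable P ?g" using wP(1) rP Tri by auto
    have "(\<integral>x. ?g x \<partial>P) = D powr p * (\<Sum>k<N. c k * b k * a k) + 2 powr p / m * (Tr * m + m * Ts)"
      unfolding rint[symmetric] Tr_def using wP rP Tri by simp
    moreover have "0 \<le> ?g x" for x
      using D c0 b0 nn m0 r0 T0 by (intro add_nonneg_nonneg mult_nonneg_nonneg sum_nonneg) auto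
    ultimately show ?thesis unfolding Bx using nn_integral_eq_integral[OF int] by simp
  qed
  have "W_pow p P Q \<le> (\<integral>\<^sup>+z. ennreal (norm (fst z - snd z) powr p) \<partial>M)"
    using W_pow_le_distr[OF M, of fst snd p] by (simp add: marg)
  also have "\<dots> = (\<integral>\<^sup>+z. ennreal (h (fst z) (snd z)) * ennreal (norm (fst z - snd z) powr p) \<partial>(P \<Otimes>\<^sub>M Q))"
    unfolding M_def by (rule nn_integral_density) measurable
  also have "\<dots> \<le> (\<integral>\<^sup>+z. ennreal (B (fst z) (snd z)) \<partial>(P \<Otimes>\<^sub>M Q))"
    using hB h0 by (intro nn_integral_mono) (simp add: ennreal_mult[symmetric] ennreal_leI)
  also have "\<dots> = (\<integral>\<^sup>+x. \<integral>\<^sup>+y. ennreal (B x y) \<partial>Q \<partial>P)"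
    unfolding B_def by (subst Q.nn_integral_fst[symmetric]) auto
  also have "\<dots> \<le> ennreal (D powr p + 2 powr p * (Tr + Ts))"
  proof (unfold Bint, rule ennreal_leI, rule add_mono)
    have "(\<Sum>k<N. c k * b k * a k) \<le> 1" using \<mu>1 cab by (simp add: mult_ac)
    then show "D powr p * (\<Sum>k<N. c k * b k * a k) \<le> D powr p" by (intro mult_left_le) auto
    have "Tr * m + m * Ts = m * (Tr + Ts)" by (simp add: algebra_simps)
    then show "2 powr p / m * (Tr * m + m * Ts) \<le> 2 powr p * (Tr + Ts)"
      using T0 by (cases "m = 0") simp_all
  qed
  finally show ?thesis unfolding Tr_def Ts_def .
qed

text \<open>
  The remainder splits into the part outside the partition, which lives on \<open>\<parallel>x\<parallel> \<ge> 2 * R\<close> where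
  \<open>\<parallel>x\<parallel> \<le> 2 * (\<parallel>x\<parallel> - R)\<close>, and the unmatched part of each bump, of mass \<open>a k - \<mu> k\<close> inside the ball of
  radius \<open>S\<close>.
\<close>

lemma residual_moment_le:
  fixes P :: "(real^'n) measure" and \<phi> :: "nat \<Rightarrow> real^'n \<Rightarrow> real" and \<mu> :: "nat \<Rightarrow> real"
  assumes P: "P \<in> finite_moment_measures p" and p: "1 \<le> p" and R: "0 < R" and S: "0 \<le> S"
    and \<phi>[measurable]: "\<And>k. \<phi> k \<in> borel_measurable borel" and nn: "\<And>k x. 0 \<le> \<phi> k x"
    and le1: "\<And>x. (\<Sum>k<N. \<phi> k x) \<le> 1"
    and eq1: "\<And>x. norm x \<le> 2 * R \<Longrightarrow> (\<Sum>k<N. \<phi> k x) = 1"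
    and supp: "\<And>k x. k < N \<Longrightarrow> 0 < \<phi> k x \<Longrightarrow> norm x \<le> S"
    and tail: "(\<integral>\<^sup>+x. ennreal (excess R x powr p) \<partial>P) \<le> ennreal t" and t: "0 \<le> t"
  defines "a \<equiv> \<lambda>k. \<integral>x. \<phi> k x \<partial>P"
  assumes \<mu>: "\<And>k. 0 \<le> \<mu> k" "\<And>k. \<mu> k \<le> a k"
  shows "(\<integral>x. (1 - (\<Sum>k<N. \<mu> k / a k * \<phi> k x)) * norm x powr p \<partial>P)
    \<le> 2 powr p * t + S powr p * (\<Sum>k<N. a k - \<mu> k)"
proof -
  interpret P: prob_space P using P by (rule finite_moment_prob_space)
  have sP[simp, measurable_cong]: "sets P = sets borel" using P by (rule finite_moment_sets)
  have le: "\<phi> k x \<le> 1" if "k < N" for k x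
    using member_le_sum[of k "{..<N}" "\<lambda>k. \<phi> k x"] nn le1[of x] that by auto
  have \<phi>P: "integrable P (\<phi> k)" if "k < N" for k
    using nn le[OF that] by (auto intro!: P.integrable_const_bound[where B = 1])
  have exi: "integrable P (\<lambda>x. excess R x powr p)"
    by (rule integrableI_bounded) (use tail in \<open>auto intro: le_less_trans\<close>)
  have ext: "(\<integral>x. excess R x powr p \<partial>P) \<le> t"
    using tail nn_integral_eq_integral[OF exi] t by (simp add: ennreal_le_iff)
  have a0: "0 \<le> a k" for k using nn by (auto simp: a_def)
  have q: "0 \<le> \<mu> k / a k" "\<mu> k / a k \<le> 1" for k
    using \<mu>[of k] a0[of k] by (auto simp: divide_le_eq)
  have ptw: "(1 - (\<Sum>k<N. \<mu> k / a k * \<phi> k x)) * norm x powr p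
     \<le> 2 powr p * excess R x powr p + S powr p * (\<Sum>k<N. (1 - \<mu> k / a k) * \<phi> k x)" for x
  proof -
    have split: "1 - (\<Sum>k<N. \<mu> k / a k * \<phi> k x) = (1 - (\<Sum>k<N. \<phi> k x)) + (\<Sum>k<N. (1 - \<mu> k / a k) * \<phi> k x)"
      by (simp add: left_diff_distrib sum_subtractf)
    have 1: "(1 - (\<Sum>k<N. \<phi> k x)) * norm x powr p \<le> 2 powr p * excess R x powr p"
    proof (cases "norm x \<le> 2 * R")
      case True then show ?thesis by (simp add: eq1)
    next
      case False
      then have "norm x \<le> 2 * excess R x" using R by (simp add: excess_def max_def)
      then have "norm x powr p \<le> (2 * excess R x) powr p" using p by (intro powr_mono2) auto
      then have "norm x powr p \<le> 2 powr p * excess R x powr p" by (simp add: powr_mult)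
      moreover have "(1 - (\<Sum>k<N. \<phi> k x)) * norm x powr p \<le> norm x powr p"
        using le1[of x] nn by (intro mult_left_le_one_le) (auto intro: sum_nonneg)
      ultimately show ?thesis by linarith
    qed
    have "(1 - \<mu> k / a k) * \<phi> k x * norm x powr p \<le> S powr p * ((1 - \<mu> k / a k) * \<phi> k x)" if k: "k < N" for k
    proof (cases "0 < \<phi> k x")
      case True
      then have "norm x powr p \<le> S powr p" using supp[OF k] p by (intro powr_mono2) auto
      then have "(1 - \<mu> k / a k) * \<phi> k x * norm x powr p \<le> (1 - \<mu> k / a k) * \<phi> k x * S powr p"
        using q[of k] True by (intro mult_left_mono) auto
      then show ?thesis by (simp add: mult_ac)
    next
      case False
      then have "\<phi> k x = 0" using nn[of k x] by simp
      then show ?thesis by simp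
    qed
    then have "(\<Sum>k<N. (1 - \<mu> k / a k) * \<phi> k x) * norm x powr p \<le> S powr p * (\<Sum>k<N. (1 - \<mu> k / a k) * \<phi> k x)"
      unfolding sum_distrib_left sum_distrib_right by (intro sum_mono) auto
    then show ?thesis using 1 unfolding split distrib_right by linarith
  qed
  let ?B = "\<lambda>x. 2 powr p * excess R x powr p + S powr p * (\<Sum>k<N. (1 - \<mu> k / a k) * \<phi> k x)"
  have \<phi>sum: "integrable P (\<lambda>x. \<Sum>k<N. (1 - \<mu> k / a k) * \<phi> k x)"
    and \<phi>sum': "(\<integral>x. (\<Sum>k<N. (1 - \<mu> k / a k) * \<phi> k x) \<partial>P) = (\<Sum>k<N. (1 - \<mu> k / a k) * a k)"
    using weighted_sum_integral[OF \<phi>P] by (auto simp: a_def)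
  have Bi: "integrable P ?B" using exi \<phi>sum by auto
  have res0: "0 \<le> 1 - (\<Sum>k<N. \<mu> k / a k * \<phi> k x)" for x
  proof -
    have "(\<Sum>k<N. \<mu> k / a k * \<phi> k x) \<le> (\<Sum>k<N. \<phi> k x)"
      using q nn by (intro sum_mono mult_left_le_one_le) auto
    then show ?thesis using le1[of x] by simp
  qed
  have "(\<integral>x. (1 - (\<Sum>k<N. \<mu> k / a k * \<phi> k x)) * norm x powr p \<partial>P) \<le> (\<integral>x. ?B x \<partial>P)"
  proof (rule integral_mono)
    show "integrable P (\<lambda>x. (1 - (\<Sum>k<N. \<mu> k / a k * \<phi> k x)) * norm x powr p)"
      by (rule Bochner_Integration.integrable_bound[OF Bi])
        (use ptw res0 in \<open>auto simp: abs_mult abs_of_nonneg intro!: AE_I2 order_trans[OF _ abs_ge_self]\<close>)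
  qed (use Bi ptw in auto)
  also have "\<dots> = 2 powr p * (\<integral>x. excess R x powr p \<partial>P) + S powr p * (\<Sum>k<N. (1 - \<mu> k / a k) * a k)"
    using exi \<phi>sum \<phi>sum' by simp
  also have "\<dots> \<le> 2 powr p * t + S powr p * (\<Sum>k<N. a k - \<mu> k)"
  proof -
    have "(1 - \<mu> k / a k) * a k = a k - \<mu> k" for k
      using \<mu>[of k] by (cases "a k = 0") (auto simp: field_simps)
    then show ?thesis using ext by simp
  qed
  finally show ?thesis .
qed

section \<open>Comparison of the topologies\<close>

lemma powr_divide_le:
  fixes e c :: real assumes "0 \<le> e" "1 \<le> c" "1 \<le> p" shows "(e / c) powr p \<le> e powr p / c"
proof -
  have "c powr 1 \<le> c powr p" using assms by (intro powr_mono) auto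
  then have "e powr p / c powr p \<le> e powr p / c" using assms by (intro divide_left_mono) auto
  then show ?thesis using assms by (simp add: powr_divide)
qed

text \<open>
  The radius \<open>R\<close> and the partition do not depend on \<open>Q\<close>, hence finitely many test functions are
  involved and \<open>\<delta>\<close> can be chosen to make the mass differences under all bumps small. Of the budget
  \<open>e = \<epsilon> powr p\<close>, a quarter is spent on the displacement \<open>4 * \<eta> = \<epsilon> / 4\<close> within the bumps, the shares
  \<open>e / 16\<close> and \<open>e / 8\<close> on the tails of \<open>P\<close> and \<open>Q\<close>, and a quarter on the unmatched mass.
\<close>

lemma wasserstein_dist_le_of_V_max:
  fixes P :: "(real^'n) measure"
  assumes P: "P \<in> finite_moment_measures p" and p: "1 \<le> p" and \<epsilon>: "0 < \<epsilon>"
  obtains \<delta> where "0 < \<delta>"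
    "\<And>Q. Q \<in> finite_moment_measures p \<Longrightarrow> V_max p P Q < \<delta> \<Longrightarrow> wasserstein_dist p P Q \<le> \<epsilon>"
proof -
  define e where "e = \<epsilon> powr p"
  have e: "0 < e" using \<epsilon> by (simp add: e_def)
  define \<eta> \<kappa> where "\<eta> = \<epsilon> / 16" and "\<kappa> = \<epsilon> / 64"
  have \<eta>: "0 < \<eta>" and \<kappa>: "0 < \<kappa>" using \<epsilon> by (auto simp: \<eta>_def \<kappa>_def)
  obtain R where R: "0 < R" and tailP: "(\<integral>\<^sup>+x. ennreal (excess R x powr p) \<partial>P) \<le> ennreal (\<kappa> powr p)"
    by (rule tail_small[OF P p \<kappa>])
  obtain N and \<phi> :: "nat \<Rightarrow> real^'n \<Rightarrow> real" where test: "\<And>k. test_fun (\<phi> k)"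
    and nn: "\<And>k x. 0 \<le> \<phi> k x" and le1: "\<And>x. (\<Sum>k<N. \<phi> k x) \<le> 1"
    and eq1: "\<And>x. norm x \<le> 2 * R \<Longrightarrow> (\<Sum>k<N. \<phi> k x) = 1"
    and diam: "\<And>k x y. 0 < \<phi> k x \<Longrightarrow> 0 < \<phi> k y \<Longrightarrow> norm (x - y) \<le> 4 * \<eta>"
    and supp: "\<And>k x. k < N \<Longrightarrow> 0 < \<phi> k x \<Longrightarrow> norm x \<le> 2 * R + 2 * \<eta>"
    by (rule partition_of_unity[OF \<eta>, of "2 * R"]) blast
  have \<phi>m: "\<phi> k \<in> borel_measurable borel" for k by (rule test_fun_measurable[OF test])
  define S where "S = 2 * R + 2 * \<eta>"
  have S: "0 \<le> S" using R \<eta> by (simp add: S_def)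
  have "\<exists>K\<ge>0. \<forall>Q\<in>finite_moment_measures p. \<forall>a. V_max p P Q < a \<longrightarrow>
      \<bar>(\<integral>x. \<phi> k x \<partial>P) - (\<integral>x. \<phi> k x \<partial>Q)\<bar> \<le> K * a" for k
  proof -
    obtain K where "0 \<le> K" "\<And>p (P :: (real^'n) measure) Q a. P \<in> finite_moment_measures p \<Longrightarrow> Q \<in> finite_moment_measures p \<Longrightarrow>
      1 \<le> p \<Longrightarrow> V_max p P Q < a \<Longrightarrow> \<bar>(\<integral>x. \<phi> k x \<partial>P) - (\<integral>x. \<phi> k x \<partial>Q)\<bar> \<le> K * a"
      using test[of k] by (rule integral_test_fun_le) blast
    then show ?thesis using P p by blast
  qed
  then obtain K where K0: "\<And>k. 0 \<le> K k" and K: "\<And>k Q a. Q \<in> finite_moment_measures p \<Longrightarrow> V_max p P Q < a \<Longrightarrow>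
      \<bar>(\<integral>x. \<phi> k x \<partial>P) - (\<integral>x. \<phi> k x \<partial>Q)\<bar> \<le> K k * a" by metis
  define C where "C = 2 powr p * (2 * (S powr p * (\<Sum>k<N. K k)))"
  have C: "0 \<le> C" unfolding C_def using K0 by (auto intro!: mult_nonneg_nonneg sum_nonneg)
  define \<delta> where "\<delta> = min \<kappa> (e / (4 * (C + 1)))"
  have \<delta>: "0 < \<delta>" using \<kappa> e C by (simp add: \<delta>_def)
  have C\<delta>: "C * \<delta> \<le> e / 4"
  proof -
    have "C * \<delta> \<le> (C + 1) * (e / (4 * (C + 1)))" using C e \<kappa> by (intro mult_mono) (auto simp: \<delta>_def)
    also have "\<dots> = e / 4" using C by (simp add: field_simps)
    finally show ?thesis .
  qed
  show thesis
  proof (rule that[OF \<delta>])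
    fix Q :: "(real^'n) measure"
    assume Q: "Q \<in> finite_moment_measures p" and V: "V_max p P Q < \<delta>"
    define a b where "a k = (\<integral>x. \<phi> k x \<partial>P)" and "b k = (\<integral>x. \<phi> k x \<partial>Q)" for k
    define \<mu> where "\<mu> k = min (a k) (b k)" for k
    have ab: "0 \<le> a k" "0 \<le> b k" for k using nn by (auto simp: a_def b_def)
    then have \<mu>0: "0 \<le> \<mu> k" and \<mu>a: "\<mu> k \<le> a k" and \<mu>b: "\<mu> k \<le> b k" for k by (auto simp: \<mu>_def)
    have close: "\<bar>a k - b k\<bar> \<le> K k * \<delta>" for k using K[OF Q V] by (simp add: a_def b_def)
    have "a k - \<mu> k \<le> K k * \<delta>" "b k - \<mu> k \<le> K k * \<delta>" for k
      using close[of k] by (auto simp: \<mu>_def min_def)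
    then have sums: "(\<Sum>k<N. a k - \<mu> k) \<le> (\<Sum>k<N. K k) * \<delta>" "(\<Sum>k<N. b k - \<mu> k) \<le> (\<Sum>k<N. K k) * \<delta>"
      unfolding sum_distrib_right by (auto intro!: sum_mono)
    have VQP: "V p Q P < \<delta>" using V by (simp add: V_max_def)
    have tailQ: "(\<integral>\<^sup>+x. ennreal (excess R x powr p) \<partial>Q) \<le> ennreal ((2 * \<kappa>) powr p)"
    proof -
      have "(\<integral>\<^sup>+x. ennreal (excess R x powr p) \<partial>Q) \<le> ennreal ((\<kappa> + \<delta>) powr p)"
        using tail_transfer[OF P Q p VQP \<kappa> _ tailP] R by simp
      also have "\<dots> \<le> ennreal ((2 * \<kappa>) powr p)"
        using \<delta> \<kappa> p by (intro ennreal_leI powr_mono2) (auto simp: \<delta>_def)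
      finally show ?thesis .
    qed
    let ?Tr = "\<integral>x. (1 - (\<Sum>k<N. \<mu> k / a k * \<phi> k x)) * norm x powr p \<partial>P"
    let ?Ts = "\<integral>x. (1 - (\<Sum>k<N. \<mu> k / b k * \<phi> k x)) * norm x powr p \<partial>Q"
    have Tr: "?Tr \<le> 2 powr p * \<kappa> powr p + S powr p * (\<Sum>k<N. a k - \<mu> k)"
      unfolding a_def
      by (rule residual_moment_le[OF P p R S \<phi>m nn le1 eq1 supp[folded S_def] tailP])
        (use \<mu>0 \<mu>a in \<open>auto simp: a_def\<close>)
    have Ts: "?Ts \<le> 2 powr p * (2 * \<kappa>) powr p + S powr p * (\<Sum>k<N. b k - \<mu> k)"
      unfolding b_def
      by (rule residual_moment_le[OF Q p R S \<phi>m nn le1 eq1 supp[folded S_def] tailQ])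
        (use \<mu>0 \<mu>b in \<open>auto simp: b_def\<close>)
    have "W_pow p P Q \<le> ennreal ((4 * \<eta>) powr p + 2 powr p * (?Tr + ?Ts))"
      unfolding \<mu>_def a_def b_def
      by (rule W_pow_partition_le[OF P Q p \<phi>m nn le1 _ diam]) (use \<eta> in auto)
    also have "\<dots> \<le> ennreal e"
    proof (rule ennreal_leI)
      have "2 powr p * (?Tr + ?Ts) \<le> 2 powr p * ((2 powr p * \<kappa> powr p + S powr p * ((\<Sum>k<N. K k) * \<delta>))
          + (2 powr p * (2 * \<kappa>) powr p + S powr p * ((\<Sum>k<N. K k) * \<delta>)))"
        using mult_left_mono[OF sums(1) powr_ge_zero[of S p]] mult_left_mono[OF sums(2) powr_ge_zero[of S p]] Tr Ts
        by (intro mult_left_mono) (linarith, simp)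
      also have "\<dots> = (4 * \<kappa>) powr p + (8 * \<kappa>) powr p + C * \<delta>"
      proof -
        have "(4 * \<kappa>) powr p = 2 powr p * (2 powr p * \<kappa> powr p)"
          "(8 * \<kappa>) powr p = 2 powr p * (2 powr p * (2 * \<kappa>) powr p)"
          using \<kappa> powr_mult[of 2 "2 * \<kappa>" p] powr_mult[of 2 \<kappa> p] powr_mult[of 2 "4 * \<kappa>" p]
            powr_mult[of 2 "2 * (2 * \<kappa>)" p] by simp_all
        then show ?thesis by (simp add: C_def algebra_simps)
      qed
      finally have "(4 * \<eta>) powr p + 2 powr p * (?Tr + ?Ts) \<le> (\<epsilon> / 4) powr p + (\<epsilon> / 16) powr p + (\<epsilon> / 8) powr p + e / 4"
        using C\<delta> by (simp add: \<eta>_def \<kappa>_def)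
      also have "\<dots> \<le> e"
      proof -
        have "(\<epsilon> / c) powr p \<le> e / c" if "1 \<le> c" for c
          unfolding e_def using \<epsilon> p that by (intro powr_divide_le) auto
        from this[of 4] this[of 16] this[of 8] show ?thesis using e by simp
      qed
      finally show "(4 * \<eta>) powr p + 2 powr p * (?Tr + ?Ts) \<le> e" .
    qed
    finally show "wasserstein_dist p P Q \<le> \<epsilon>"
      unfolding wasserstein_dist_W_pow using \<epsilon> p by (intro le_imp_root_le) (auto simp: e_def)
  qed
qed

text \<open>
  Couplings of arbitrarily small cost exist, and each bounds the difference of the integrals by the
  Lipschitz constant times the mean displacement.
\<close>

lemma integral_lipschitz_eq:
  fixes P Q :: "(real^'n) measure" and f :: "real^'n \<Rightarrow> real"
  assumes P: "P \<in> finite_moment_measures p" and Q: "Q \<in> finite_moment_measures p" and p: "1 \<le> p"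
    and W: "wasserstein_dist p P Q = 0"
    and f: "f \<in> borel_measurable borel" "integrable P f" "integrable Q f"
    and L: "0 \<le> L" and lip: "\<And>x y. \<bar>f x - f y\<bar> \<le> L * norm (x - y)"
  shows "(\<integral>x. f x \<partial>P) = (\<integral>x. f x \<partial>Q)"
proof -
  have "\<bar>(\<integral>x. f x \<partial>P) - (\<integral>x. f x \<partial>Q)\<bar> \<le> L * a" if a: "0 < a" for a
  proof -
    obtain \<pi> where \<pi>: "\<pi> \<in> Cpl P Q" and le: "(\<integral>\<^sup>+z. ennreal (norm (fst z - snd z) powr p) \<partial>\<pi>) \<le> ennreal (a powr p)"
      by (rule wasserstein_dist_less_obtain[OF P Q p, of a]) (use W a in auto)
    interpret prob_space \<pi> using \<pi> by (rule Cpl_prob)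
    note ints = Cpl_moment_integrable[OF P Q p \<pi>]
    then have sm: "fst \<in> measurable \<pi> borel" "snd \<in> measurable \<pi> borel" by auto
    have mean: "(\<integral>z. norm (fst z - snd z) \<partial>\<pi>) \<le> a"
      by (rule mean_norm_le(2)[OF _ p a le]) (use sm in auto)
    have fi: "integrable \<pi> (\<lambda>z. f (fst z))" "integrable \<pi> (\<lambda>z. f (snd z))"
      using Cpl_integrable[OF \<pi> f(1)] f by auto
    have "(\<integral>x. f x \<partial>P) - (\<integral>x. f x \<partial>Q) = (\<integral>z. f (fst z) - f (snd z) \<partial>\<pi>)"
      using \<pi> integral_distr[OF sm(1) f(1)] integral_distr[OF sm(2) f(1)] fi by (simp add: Cpl_def)
    then have "\<bar>(\<integral>x. f x \<partial>P) - (\<integral>x. f x \<partial>Q)\<bar> \<le> (\<integral>z. \<bar>f (fst z) - f (snd z)\<bar> \<partial>\<pi>)" by simp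
    also have "\<dots> \<le> (\<integral>z. L * norm (fst z - snd z) \<partial>\<pi>)"
      using fi ints lip by (intro integral_mono) auto
    also have "\<dots> \<le> L * a" using mean L by (simp add: mult_left_mono)
    finally show ?thesis .
  qed
  note bound = this
  have "\<bar>(\<integral>x. f x \<partial>P) - (\<integral>x. f x \<partial>Q)\<bar> \<le> 0"
  proof (rule field_le_epsilon)
    fix e :: real assume e: "0 < e"
    have "L * (e / (L + 1)) \<le> e" using L e by (simp add: field_simps)
    then show "\<bar>(\<integral>x. f x \<partial>P) - (\<integral>x. f x \<partial>Q)\<bar> \<le> 0 + e" using bound[of "e / (L + 1)"] L e by simp
  qed
  then show ?thesis by simp
qed

text \<open>
  The indicator of a closed set is the limit of the Lipschitz functions \<open>max 0 (1 - n * infdist x C)\<close>, and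
  closed sets are an intersection-stable generator of the Borel sets.
\<close>

lemma wasserstein_dist_eq_0_imp_eq:
  fixes P Q :: "(real^'n) measure"
  assumes P: "P \<in> finite_moment_measures p" and Q: "Q \<in> finite_moment_measures p" and p: "1 \<le> p"
    and W: "wasserstein_dist p P Q = 0"
  shows "P = Q"
proof -
  interpret P: prob_space P using P by (rule finite_moment_prob_space)
  interpret Q: prob_space Q using Q by (rule finite_moment_prob_space)
  have sP[simp, measurable_cong]: "sets P = sets borel" using P by (rule finite_moment_sets)
  have sQ[simp, measurable_cong]: "sets Q = sets borel" using Q by (rule finite_moment_sets)
  have closed_eq: "emeasure P C = emeasure Q C" if C: "closed C" for C
  proof (cases "C = {}")
    case False
    define f where "f n x = max 0 (1 - real n * infdist x C)" for n x
    have fm[measurable]: "f n \<in> borel_measurable borel" for n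
      unfolding f_def by (intro borel_measurable_continuous_onI continuous_intros)
    have f01: "0 \<le> f n x" "f n x \<le> 1" for n x by (auto simp: f_def infdist_nonneg)
    have fi: "integrable P (f n)" "integrable Q (f n)" for n
      using f01 by (auto intro!: P.integrable_const_bound[where B = 1] Q.integrable_const_bound[where B = 1])
    have lip: "\<bar>f n x - f n y\<bar> \<le> real n * norm (x - y)" for n x y
    proof -
      have "\<bar>f n x - f n y\<bar> \<le> \<bar>real n * infdist x C - real n * infdist y C\<bar>"
        by (auto simp: f_def max_def)
      also have "\<dots> = real n * \<bar>infdist x C - infdist y C\<bar>"
        by (simp add: abs_mult flip: right_diff_distrib)
      also have "\<dots> \<le> real n * norm (x - y)"
        using infdist_triangle_abs[of x C y] by (intro mult_left_mono) (auto simp: dist_norm)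
      finally show ?thesis .
    qed
    have lim: "(\<lambda>n. f n x) \<longlonglongrightarrow> indicator C x" for x
    proof (rule tendsto_eventually)
      show "eventually (\<lambda>n. f n x = indicator C x) sequentially"
      proof (cases "x \<in> C")
        case True then show ?thesis by (simp add: f_def)
      next
        case out: False
        then have pos: "0 < infdist x C"
          using C False in_closed_iff_infdist_zero[of C x] infdist_nonneg[of x C] by linarith
        obtain N where "1 / infdist x C \<le> real N" using real_arch_simple by blast
        then have N: "1 \<le> real N * infdist x C" using pos by (simp add: field_simps)
        show ?thesis
        proof (intro eventually_sequentiallyI[of N])
          fix n assume "N \<le> n"
          then have "real N * infdist x C \<le> real n * infdist x C" using pos by (intro mult_right_mono) auto
          then show "f n x = indicator C x" using N out by (simp add: f_def)
        qed
      qed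
    qed
    have [measurable]: "C \<in> sets borel" using C by (rule borel_closed)
    have intC: "(\<lambda>n. \<integral>x. f n x \<partial>P) \<longlonglongrightarrow> (\<integral>x. indicator C x \<partial>P)"
      by (rule integral_dominated_convergence[where w = "\<lambda>_. 1"])
        (use f01 lim in auto)
    have intC': "(\<lambda>n. \<integral>x. f n x \<partial>Q) \<longlonglongrightarrow> (\<integral>x. indicator C x \<partial>Q)"
      by (rule integral_dominated_convergence[where w = "\<lambda>_. 1"])
        (use f01 lim in auto)
    have "(\<integral>x. f n x \<partial>P) = (\<integral>x. f n x \<partial>Q)" for n
      by (rule integral_lipschitz_eq[OF P Q p W fm fi(1) fi(2) _ lip]) simp
    then have "(\<integral>x. indicator C x \<partial>P) = (\<integral>x. indicator C x \<partial>Q :: real)"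
      using LIMSEQ_unique[OF intC] intC' by simp
    then have "measure P C = measure Q C" using C by (simp add: borel_closed)
    then show ?thesis by (simp add: P.emeasure_eq_measure Q.emeasure_eq_measure)
  qed simp
  show ?thesis
  proof (rule measure_eqI_generator_eq[where E = "Collect closed" and \<Omega> = UNIV and A = "\<lambda>_. UNIV"])
    show "Int_stable (Collect closed :: (real^'n) set set)" by (auto simp: Int_stable_def)
    show "sets P = sigma_sets UNIV (Collect closed)" "sets Q = sigma_sets UNIV (Collect closed)"
      unfolding sP sQ by (simp_all add: borel_eq_closed)
  qed (use closed_eq in auto)
qed

lemma wasserstein_dist_self:
  fixes P :: "(real^'n) measure"
  assumes P: "P \<in> finite_moment_measures p" and p: "1 \<le> p" shows "wasserstein_dist p P P = 0"
proof -
  have s: "sets P = sets borel" using P by (rule finite_moment_sets)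
  have m: "(\<lambda>x. x) \<in> measurable P borel" unfolding measurable_cong_sets[OF s refl] by simp
  have "distr P borel (\<lambda>x. x) = P" using s by (intro measure_eqI) (auto simp: emeasure_distr m)
  moreover have "wasserstein_dist p (distr P borel (\<lambda>x. x)) (distr P borel (\<lambda>x. x)) \<le> 0"
    by (rule wasserstein_dist_le[OF finite_moment_prob_space[OF P] m m p]) auto
  ultimately show ?thesis using wasserstein_dist_nonneg[of p P P] by simp
qed

lemma Metric_space_wasserstein_dist:
  assumes "1 \<le> p"
  shows "Metric_space (finite_moment_measures p :: (real^'n) measure set) (wasserstein_dist p)"
  using assms wasserstein_dist_nonneg wasserstein_dist_commute wasserstein_dist_eq_0_imp_eq
    wasserstein_dist_self wasserstein_dist_triangle
  unfolding Metric_space_def by metis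

lemma V_max_le_wasserstein_dist:
  fixes P Q :: "(real^'n) measure"
  assumes "P \<in> finite_moment_measures p" "Q \<in> finite_moment_measures p" "1 \<le> p"
  shows "V_max p P Q \<le> wasserstein_dist p P Q"
  using V_le_wasserstein_dist[of P p Q] V_le_wasserstein_dist[of Q p P] wasserstein_dist_commute[of p P Q] assms
  by (simp add: V_max_def)

lemma V_max_nonneg: "0 \<le> V_max p P Q"
  by (simp add: V_max_def V_nonneg le_max_iff_disj)

text \<open>
  Vanishing of \<open>V\<close> in one direction only says that one measure is dominated by the other in convex order;
  the maximum makes \<open>W\<^sub>p\<close> vanish.
\<close>

lemma V_max_eq_0_iff:
  fixes P Q :: "(real^'n) measure"
  assumes P: "P \<in> finite_moment_measures p" and Q: "Q \<in> finite_moment_measures p" and p: "1 \<le> p"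
  shows "V_max p P Q = 0 \<longleftrightarrow> P = Q"
proof
  assume V: "V_max p P Q = 0"
  have "wasserstein_dist p P Q \<le> 0"
  proof (rule field_le_epsilon)
    fix e :: real assume "0 < e"
    then obtain \<delta> where "0 < \<delta>" "\<And>Q. Q \<in> finite_moment_measures p \<Longrightarrow> V_max p P Q < \<delta> \<Longrightarrow> wasserstein_dist p P Q \<le> e"
      using wasserstein_dist_le_of_V_max[OF P p] by blast
    then show "wasserstein_dist p P Q \<le> 0 + e" using V Q by simp
  qed
  then show "P = Q" using wasserstein_dist_eq_0_imp_eq[OF P Q p] wasserstein_dist_nonneg[of p P Q] by simp
next
  assume "P = Q"
  then show "V_max p P Q = 0"
    using V_max_le_wasserstein_dist[OF P Q p] wasserstein_dist_self[OF P p] V_max_nonneg[of p P Q] by simp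
qed

lemma Metric_space_V_max:
  assumes p: "1 \<le> p"
  shows "Metric_space (finite_moment_measures p :: (real^'n) measure set) (V_max p)"
proof
  show "V_max p P Q = V_max p Q P" for P Q :: "(real^'n) measure" by (simp add: V_max_def max.commute)
  show "V_max p P R \<le> V_max p P Q + V_max p Q R"
    if "P \<in> finite_moment_measures p" "Q \<in> finite_moment_measures p" "R \<in> finite_moment_measures p"
    for P Q R :: "(real^'n) measure"
    using V_triangle[OF that p] V_triangle[OF that(3,2,1) p] by (auto simp: V_max_def)
qed (simp_all add: V_max_nonneg V_max_eq_0_iff[OF _ _ p])

theorem proposition12:
  fixes p :: real
  assumes "1 \<le> p"
  shows "Metric_space (finite_moment_measures p :: (real ^ 'n) measure set) (V_max p) \<and>
    Metric_space.mtopology (finite_moment_measures p :: (real ^ 'n) measure set) (V_max p)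
      = wasserstein_topology p"
proof
  let ?M = "finite_moment_measures p :: (real ^ 'n) measure set"
  show V: "Metric_space ?M (V_max p)" using assms by (rule Metric_space_V_max)
  have W: "Metric_space ?M (wasserstein_dist p)" using assms by (rule Metric_space_wasserstein_dist)
  interpret V: Metric_space ?M "V_max p" by (rule V)
  interpret W: Metric_space ?M "wasserstein_dist p" by (rule W)
  have 1: "\<exists>s>0. V.mball P s \<subseteq> W.mball P r" if P: "P \<in> ?M" and r: "0 < r" for P r
  proof -
    have "0 < r / 2" using r by simp
    then obtain \<delta> where "0 < \<delta>" "\<And>Q. Q \<in> ?M \<Longrightarrow> V_max p P Q < \<delta> \<Longrightarrow> wasserstein_dist p P Q \<le> r / 2"
      using wasserstein_dist_le_of_V_max[OF P assms] by blast
    then show ?thesis using P r by (intro exI[of _ \<delta>]) fastforce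
  qed
  have 2: "W.mball P r \<subseteq> V.mball P r" for P r
    using V_max_le_wasserstein_dist[OF _ _ assms] by (auto intro!: le_less_trans[of "V_max p P _" "wasserstein_dist p P _" r])
  have "V.mopen U = W.mopen U" for U
    unfolding V.mopen_def W.mopen_def using 1 2 by (meson subset_iff subset_trans)
  then have "V.mopen = W.mopen" by auto
  then show "V.mtopology = wasserstein_topology p"
    by (simp add: wasserstein_topology_def V.mtopology_def W.mtopology_def)
qed

end
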